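(* Let $L_1(t)$ be the total maintenance loss on $[0,t]$ of the system described in the context under the periodic replacement policy with period $T>0$, and let $C_1(T):=\lim_{t\to\infty}\frac{\mathbb{E}[L_1(t)]}{t}$ be the long-run average expected loss per unit time. Then the optimal replacement period is $T_1^*:=\arg\min_{T} C_1(T)$, where $$C_1(T)=\frac{c_f\,\mathbb{E}[N(T)]+c_{Ip}\,\mathbb{E}[N_R(T)]+c_p}{T},$$ where $N_R(t)$ is the renewal process with interarrivals $Y_1,Y_2,\ldots$, so that $\mathbb{E}[N_R(t)]=\sum_{n=1}^\infty F^{(n)}(t)$, with $F^{(n)}$ the $n$-fold convolution of the distribution function $F$ of the interarrivals with itself, and $N(t)$ is a renewal Hawkes process, represented by $N_i(t)$ for the $\mathrm{R}_i$Hawkes process, $i=1,2,3$.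
   Context: Data: $\mu$ is a positive function on $[0,\infty)$, $\eta>0$, $h$ is a positive locally bounded function on $[0,\infty)$ with $\int_0^\infty h=1$. Put $G(t)=1-e^{-\int_0^t\mu(v)\,\mathrm{d}v}$. $Y_1,Y_2,\ldots$ are positive i.i.d. exogenous random variables with distribution function $F$ and density $f$. Renewal Hawkes processes: for $i=1,2,3$, the $\mathrm{R}_i$Hawkes process $N_i(t)$ is a simple point process with $N_i(0)=0$ and intensity (relative to the filtration generated by $N_i$ and the past renewal times) $\lambda_i(t)=\mu(t-R^{(i)}(t))+\eta\int_0^{t-}h(t-v)\,\mathrm{d}N_i(v)$, where $R^{(i)}(t)$ is the last renewal time strictly before $t$ ($0$ if none). For $i=1$ the renewal times are $Y_1,\,Y_1+Y_2,\ldots$. For $i=2$ they are $V_0=0$, $V_j=\min(Y_j+V_{j-1},T_j)$, $T_j$ being the first immigration virtual event time after $V_{j-1}$ ($T_j-V_{j-1}$ has distribution function $G$, independent of the past and of $Y_j$; it is an actual event if $V_j=T_j$). For $i=3$ they are $W_0=0$, $W_j=\max(Y_j+W_{j-1},T_j)$, $T_j$ being the first immigration event time after $W_{j-1}$ ($T_j-W_{j-1}$ has distribution function $G$, independent of the past and of $Y_j$). System and policy: a system has two parts, A (single unit) and B (multiple devices). Part A has failure rate function $\mu$; part B suffers cascading failures caused by part A and by itself. The number of failures of the whole system since its last replacement is modelled by $N(t)$, one of $N_1,N_2,N_3$. All failures receive minimal repair, each costing $c_f$. Part A is renewed at the environmental change times $Y_1,Y_1+Y_2,\ldots$ within a cycle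 (counted by $N_R$), each such renewal costing $c_{Ip}$. The whole system is preventively replaced at the instants $jT$, $j=1,2,\ldots$, each replacement costing $c_p$ and restarting the whole system afresh (independent copy). Repair and replacement durations are negligible. $L_1(t)$ is the accumulated cost of all these actions during $[0,t]$. *)

theory Defs
  imports "HOL-Probability.Probability"
begin

section \<open>Point processes and stochastic intensities\<close>

text \<open>
  A simple point process on \<open>(0,\<infinity>)\<close> is given by its random set of event times. Its counting
  process is \<open>N(t) = counting (P \<omega>) t\<close>, and \<open>\<integral> C(v) dN(v)\<close> is the sum of \<open>C\<close> over the event
  times. The indices \<open>0, 1, ...\<close> of \<open>Y\<close> and \<open>D\<close> below stand for the mathematical indices
  \<open>1, 2, ...\<close>.
\<close>

definition counting :: "real set \<Rightarrow> real \<Rightarrow> nat" where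
  "counting A t = card (A \<inter> {0<..t})"

definition simple_point_process :: "'a measure \<Rightarrow> ('a \<Rightarrow> real set) \<Rightarrow> bool" where
  "simple_point_process M P \<longleftrightarrow>
     (\<forall>\<omega>\<in>space M. P \<omega> \<subseteq> {0<..} \<and> (\<forall>t. finite (P \<omega> \<inter> {0<..t}))) \<and>
     (\<forall>t. (\<lambda>\<omega>. counting (P \<omega>) t) \<in> M \<rightarrow>\<^sub>M count_space UNIV)"

definition predictable :: "'a set \<Rightarrow> (real \<Rightarrow> 'a measure) \<Rightarrow> (real \<times> 'a) measure" where
  "predictable \<Omega> H = sigma ({0<..} \<times> \<Omega>) {{s<..t} \<times> A | s t A. 0 \<le> s \<and> s < t \<and> A \<in> sets (H s)}"

text \<open>
  Stochastic intensity with respect to a history \<open>H\<close>, in the usual martingale sense: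
  \<open>E \<integral> C dN = E \<integral> C \<lambda> ds\<close> for all nonnegative predictable integrands \<open>C\<close>.
\<close>

definition has_intensity ::
  "'a measure \<Rightarrow> (real \<Rightarrow> 'a measure) \<Rightarrow> ('a \<Rightarrow> real set) \<Rightarrow> (real \<Rightarrow> 'a \<Rightarrow> real) \<Rightarrow> bool" where
  "has_intensity M H P lam \<longleftrightarrow>
     (\<lambda>(t, \<omega>). lam t \<omega>) \<in> borel_measurable (predictable (space M) H) \<and>
     (\<forall>t>0. \<forall>\<omega>\<in>space M. 0 \<le> lam t \<omega>) \<and>
     (AE \<omega> in M. \<forall>t. set_integrable lborel {0<..t} (\<lambda>s. lam s \<omega>)) \<and>
     (\<forall>C :: real \<times> 'a \<Rightarrow> ennreal. C \<in> borel_measurable (predictable (space M) H) \<longrightarrow>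
        (\<integral>\<^sup>+\<omega>. (\<integral>\<^sup>+v. C (v, \<omega>) \<partial>count_space (P \<omega>)) \<partial>M) =
        (\<integral>\<^sup>+\<omega>. (\<integral>\<^sup>+v\<in>{0<..}. C (v, \<omega>) * ennreal (lam v \<omega>) \<partial>lborel) \<partial>M))"

text \<open>
  Independence of two random elements whose value types may differ, which the type of
  \<^const>\<open>prob_space.indep_var\<close> does not allow.
\<close>

definition independent ::
  "'a measure \<Rightarrow> 'b measure \<Rightarrow> ('a \<Rightarrow> 'b) \<Rightarrow> 'c measure \<Rightarrow> ('a \<Rightarrow> 'c) \<Rightarrow> bool" where
  "independent M A X B Z \<longleftrightarrow> X \<in> M \<rightarrow>\<^sub>M A \<and> Z \<in> M \<rightarrow>\<^sub>M B \<and>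
     prob_space.indep_set M (sets (vimage_algebra (space M) X A)) (sets (vimage_algebra (space M) Z B))"


section \<open>Renewal Hawkes processes\<close>

datatype renewal_kind = R1 | R2 | R3

text \<open>
  \<open>d j\<close> is the waiting time from the \<open>j\<close>-th renewal time to the next (virtual) immigration event.
  It is extended-real-valued because \<open>G\<close> is defective if \<open>\<mu>\<close> has finite integral. It plays no role
  in the dynamics of kind \<open>R1\<close>, where it can be taken to be constant.
\<close>

primrec renewal_time :: "renewal_kind \<Rightarrow> (nat \<Rightarrow> real) \<Rightarrow> (nat \<Rightarrow> ereal) \<Rightarrow> nat \<Rightarrow> ereal" where
  "renewal_time i y d 0 = 0"
| "renewal_time i y d (Suc j) =
     (let r = renewal_time i y d j in
      case i of
        R1 \<Rightarrow> ereal (y j) + r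
      | R2 \<Rightarrow> min (ereal (y j) + r) (r + d j)
      | R3 \<Rightarrow> max (ereal (y j) + r) (r + d j))"

definition last_renewal :: "(nat \<Rightarrow> ereal) \<Rightarrow> real \<Rightarrow> real" where
  "last_renewal \<tau> t = Sup (insert 0 {r. r < t \<and> (\<exists>j. \<tau> j = ereal r)})"

definition rh_intensity ::
  "(real \<Rightarrow> real) \<Rightarrow> real \<Rightarrow> (real \<Rightarrow> real) \<Rightarrow> real set \<Rightarrow> (nat \<Rightarrow> ereal) \<Rightarrow> real \<Rightarrow> real" where
  "rh_intensity \<mu> \<eta> h A \<tau> t = \<mu> (t - last_renewal \<tau> t) + \<eta> * (\<Sum>v\<in>A \<inter> {0<..<t}. h (t - v))"

definition rh_history ::
  "'a measure \<Rightarrow> ('a \<Rightarrow> real set) \<Rightarrow> (nat \<Rightarrow> 'a \<Rightarrow> ereal) \<Rightarrow> real \<Rightarrow> 'a measure" where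
  "rh_history M P \<tau> t = sigma (space M)
     ({{\<omega>\<in>space M. counting (P \<omega>) s = n} | s n. 0 \<le> s \<and> s \<le> t} \<union>
      {{\<omega>\<in>space M. \<tau> j \<omega> \<le> ereal s} | j s. 0 \<le> s \<and> s \<le> t})"

text \<open>
  The past of the \<open>j\<close>-th renewal time: the point process stopped at that time, together with the
  variables \<open>Y\<close> and \<open>D\<close> of the preceding renewal intervals.
\<close>

definition past_space ::
  "nat \<Rightarrow> ((real \<Rightarrow> nat) \<times> (nat \<Rightarrow> real) \<times> (nat \<Rightarrow> ereal)) measure" where
  "past_space j = (\<Pi>\<^sub>M s\<in>UNIV. count_space UNIV) \<Otimes>\<^sub>M (\<Pi>\<^sub>M k\<in>{..<j}. borel) \<Otimes>\<^sub>M (\<Pi>\<^sub>M k\<in>{..<j}. borel)"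

definition past ::
  "('a \<Rightarrow> real set) \<Rightarrow> (nat \<Rightarrow> 'a \<Rightarrow> real) \<Rightarrow> (nat \<Rightarrow> 'a \<Rightarrow> ereal) \<Rightarrow> (nat \<Rightarrow> 'a \<Rightarrow> ereal) \<Rightarrow>
   nat \<Rightarrow> 'a \<Rightarrow> (real \<Rightarrow> nat) \<times> (nat \<Rightarrow> real) \<times> (nat \<Rightarrow> ereal)" where
  "past P Y D \<tau> j \<omega> =
     (\<lambda>s. counting {v \<in> P \<omega>. ereal v \<le> \<tau> j \<omega>} s, \<lambda>k\<in>{..<j}. Y k \<omega>, \<lambda>k\<in>{..<j}. D k \<omega>)"

definition immigration_cdf :: "(real \<Rightarrow> real) \<Rightarrow> real \<Rightarrow> real" where
  "immigration_cdf \<mu> t = 1 - exp (- (LBINT v:{0..t}. \<mu> v))"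

text \<open>
  The \<open>R\<^sub>i\<close>Hawkes process. The interarrivals being exogenous is the condition that \<open>Y j\<close> is
  independent of the past of the \<open>j\<close>-th renewal time. For \<open>R2\<close> and \<open>R3\<close>, the immigration time
  \<open>renewal time + D j\<close> is an event of the process unless it lies beyond the next renewal time
  (which can only happen for \<open>R2\<close>, where it then stays virtual).
\<close>

definition renewal_hawkes ::
  "'a measure \<Rightarrow> renewal_kind \<Rightarrow> (real \<Rightarrow> real) \<Rightarrow> real \<Rightarrow> (real \<Rightarrow> real) \<Rightarrow>
   (real \<Rightarrow> real) \<Rightarrow> (real \<Rightarrow> real) \<Rightarrow>
   ('a \<Rightarrow> real set) \<Rightarrow> (nat \<Rightarrow> 'a \<Rightarrow> real) \<Rightarrow> (nat \<Rightarrow> 'a \<Rightarrow> ereal) \<Rightarrow> bool" where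
  "renewal_hawkes M i \<mu> \<eta> h F f P Y D \<longleftrightarrow>
     (let \<tau> = (\<lambda>j \<omega>. renewal_time i (\<lambda>k. Y k \<omega>) (\<lambda>k. D k \<omega>) j) in
        simple_point_process M P \<and>
        prob_space.indep_vars M (\<lambda>_. borel) Y UNIV \<and>
        (\<forall>j. distributed M lborel (Y j) (\<lambda>y. ennreal (f y))) \<and>
        (\<forall>j t. measure M {\<omega>\<in>space M. Y j \<omega> \<le> t} = F t) \<and>
        (\<forall>j. \<forall>\<omega>\<in>space M. 0 < Y j \<omega>) \<and>
        (\<forall>j. independent M borel (Y j) (past_space j) (past P Y D \<tau> j)) \<and>
        (i \<noteq> R1 \<longrightarrow>
           (\<forall>j. D j \<in> borel_measurable M) \<and>
           (\<forall>j. \<forall>t\<ge>0. measure M {\<omega>\<in>space M. D j \<omega> \<le> ereal t} = immigration_cdf \<mu> t) \<and>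
           (\<forall>j. independent M borel (D j)
                  (past_space j \<Otimes>\<^sub>M borel) (\<lambda>\<omega>. (past P Y D \<tau> j \<omega>, Y j \<omega>))) \<and>
           (AE \<omega> in M. \<forall>j r. \<tau> j \<omega> + D j \<omega> = ereal r \<and> ereal r \<le> \<tau> (Suc j) \<omega> \<longrightarrow> r \<in> P \<omega>)) \<and>
        has_intensity M (rh_history M P \<tau>) P
          (\<lambda>t \<omega>. rh_intensity \<mu> \<eta> h (P \<omega>) (\<lambda>j. \<tau> j \<omega>) t))"


section \<open>The maintained system\<close>

text \<open>The number \<open>N\<^sub>R(t)\<close> of environmental changes \<open>Y\<^sub>1, Y\<^sub>1 + Y\<^sub>2, ...\<close> up to time \<open>t\<close>.
  The set below is infinite, and its cardinality then 0, only on a null set.\<close>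

definition env_changes :: "(nat \<Rightarrow> real) \<Rightarrow> real \<Rightarrow> nat" where
  "env_changes y t = card {n. (\<Sum>k\<le>n. y k) \<le> t}"

text \<open>
  \<open>conv_power F n\<close> is \<open>F\<^sup>(\<^sup>n\<^sup>)\<close>, that is, \<open>F\<^sup>(\<^sup>n\<^sup>+\<^sup>1\<^sup>)(t) = \<integral> F\<^sup>(\<^sup>n\<^sup>)(t - y) dF(y)\<close> with a Stieltjes
  integral; \<open>n = 0\<close> is the distribution function of the point mass at 0.
\<close>

primrec conv_power :: "(real \<Rightarrow> real) \<Rightarrow> nat \<Rightarrow> real \<Rightarrow> real" where
  "conv_power F 0 t = indicator {0..} t"
| "conv_power F (Suc n) t = (LINT y|interval_measure F. conv_power F n (t - y))"

text \<open>
  The system in its \<open>j\<close>-th replacement cycle (\<open>j = 0, 1, ...\<close>) is described by \<open>P j\<close>, \<open>Y j\<close> and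
  \<open>D j\<close>, with time measured from the start of the cycle. They are defined on all of \<open>[0,\<infinity>)\<close>, so that
  the same cycles serve for every replacement period.
\<close>

definition cycle_space :: "((real \<Rightarrow> nat) \<times> (nat \<Rightarrow> real) \<times> (nat \<Rightarrow> ereal)) measure" where
  "cycle_space = (\<Pi>\<^sub>M s\<in>UNIV. count_space UNIV) \<Otimes>\<^sub>M (\<Pi>\<^sub>M k\<in>UNIV. borel) \<Otimes>\<^sub>M (\<Pi>\<^sub>M k\<in>UNIV. borel)"

definition cycle ::
  "('a \<Rightarrow> real set) \<Rightarrow> (nat \<Rightarrow> 'a \<Rightarrow> real) \<Rightarrow> (nat \<Rightarrow> 'a \<Rightarrow> ereal) \<Rightarrow>
   'a \<Rightarrow> (real \<Rightarrow> nat) \<times> (nat \<Rightarrow> real) \<times> (nat \<Rightarrow> ereal)" where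
  "cycle P Y D \<omega> = (counting (P \<omega>), \<lambda>k. Y k \<omega>, \<lambda>k. D k \<omega>)"

definition independent_copies ::
  "'a measure \<Rightarrow> (nat \<Rightarrow> 'a \<Rightarrow> real set) \<Rightarrow> (nat \<Rightarrow> nat \<Rightarrow> 'a \<Rightarrow> real) \<Rightarrow>
   (nat \<Rightarrow> nat \<Rightarrow> 'a \<Rightarrow> ereal) \<Rightarrow> bool" where
  "independent_copies M P Y D \<longleftrightarrow>
     prob_space.indep_vars M (\<lambda>_. cycle_space) (\<lambda>j. cycle (P j) (Y j) (D j)) UNIV \<and>
     (\<forall>j. distr M cycle_space (cycle (P j) (Y j) (D j)) =
          distr M cycle_space (cycle (P 0) (Y 0) (D 0)))"

text \<open>
  The accumulated cost on \<open>[0,t]\<close>: \<open>\<lfloor>t/T\<rfloor>\<close> completed cycles, each ended by a replacement, followed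
  by the running cycle, whose age is \<open>t - \<lfloor>t/T\<rfloor> T\<close>.
\<close>

definition maintenance_loss ::
  "real \<Rightarrow> real \<Rightarrow> real \<Rightarrow> (nat \<Rightarrow> 'a \<Rightarrow> real set) \<Rightarrow> (nat \<Rightarrow> nat \<Rightarrow> 'a \<Rightarrow> real) \<Rightarrow>
   real \<Rightarrow> real \<Rightarrow> 'a \<Rightarrow> real" where
  "maintenance_loss c_f c_Ip c_p P Y T t \<omega> =
     (let m = nat \<lfloor>t / T\<rfloor>;
          minor_cost = (\<lambda>j s. c_f * real (counting (P j \<omega>) s) + c_Ip * real (env_changes (\<lambda>k. Y j k \<omega>) s))
      in (\<Sum>j<m. minor_cost j T + c_p) + minor_cost m (t - real m * T))"

definition expected_failures :: "'a measure \<Rightarrow> ('a \<Rightarrow> real set) \<Rightarrow> real \<Rightarrow> real" where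
  "expected_failures M P t = (LINT \<omega>|M. real (counting (P \<omega>) t))"

definition expected_changes :: "'a measure \<Rightarrow> (nat \<Rightarrow> 'a \<Rightarrow> real) \<Rightarrow> real \<Rightarrow> real" where
  "expected_changes M Y t = (LINT \<omega>|M. real (env_changes (\<lambda>k. Y k \<omega>) t))"

definition long_run_loss ::
  "'a measure \<Rightarrow> real \<Rightarrow> real \<Rightarrow> real \<Rightarrow> (nat \<Rightarrow> 'a \<Rightarrow> real set) \<Rightarrow> (nat \<Rightarrow> nat \<Rightarrow> 'a \<Rightarrow> real) \<Rightarrow>
   real \<Rightarrow> real" where
  "long_run_loss M c_f c_Ip c_p P Y T =
     Lim at_top (\<lambda>t. (LINT \<omega>|M. maintenance_loss c_f c_Ip c_p P Y T t \<omega>) / t)"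

definition optimal_period :: "(real \<Rightarrow> real) \<Rightarrow> real \<Rightarrow> bool" where
  "optimal_period C T \<longleftrightarrow> is_arg_min C (\<lambda>T. 0 < T) T"

end

theory Submission
  imports Defs
begin

text \<open>
  The replacement times \<open>j T\<close> are deterministic and the cycles have the same law. Hence the expected
  loss up to \<open>t\<close> is the number \<open>\<lfloor>t/T\<rfloor>\<close> of completed cycles times the expected cost of one cycle, plus the
  expected cost of a running cycle of age less than \<open>T\<close>. The mean counts of failures and of changes
  grow with the age, so the last term is bounded, and division by \<open>t\<close> gives the cost rate
  (\<open>renewal_reward_limit\<close>). The limit and the formula for it agree for every \<open>T > 0\<close>, so they have the
  same minimisers. The expected number of environmental changes is the sum of the probabilities that
  the \<open>n\<close>-th change occurs by \<open>t\<close>, and these are the convolution powers of \<open>F\<close> (\<open>renewal_function\<close>).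

  All this presupposes finite means, and the substance of the proof is that the mean number of
  failures up to \<open>t\<close> is finite although \<open>\<mu>\<close> is merely locally integrable. The intensity has two parts.

  The immigration part integrates to at most the integral of \<open>\<mu>\<close> over \<open>[0,t]\<close> for every renewal before
  \<open>t\<close>. Renewals are rare: for a suitable \<open>e > 0\<close> each renewal gap is longer than \<open>e\<close> with conditional
  probability at least \<open>1/2\<close> given the past, so the \<open>n\<close>-th renewal precedes \<open>t\<close> with a probability that
  decays exponentially in \<open>n\<close> (\<open>early_renewal_exponentially_unlikely\<close>). Thus the mean number of
  renewals before \<open>t\<close> is finite.

  The excitation part is controlled by the process itself. With \<open>h \<le> B\<close> on \<open>[0,t]\<close>, the mean number of
  events in an interval of length \<open>\<delta>\<close> exceeds the immigration part by at most \<open>\<eta> B \<delta>\<close> times the mean number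
  of events up to its end. For \<open>\<eta> B \<delta> \<le> 1/2\<close> that term is absorbed into the left-hand side
  (\<open>expected_events_finite_step\<close>). To make this legitimate, the process is first stopped at its \<open>n\<close>-th
  event, which amounts to testing the intensity with a bounded predictable integrand; then \<open>n\<close> tends to
  infinity. Finitely many such steps cover \<open>[0,t]\<close>.
\<close>

section \<open>Independence of random elements\<close>

text \<open>
  Independence is assumed at the level of generated \<open>\<sigma>\<close>-algebras of random elements with values in
  different types. The library's product rule for expectations needs two real random variables, which
  generate smaller \<open>\<sigma>\<close>-algebras when they are functions of the given random elements.
\<close>

lemma (in prob_space) independent_expectation:
  assumes ind: "independent M A X B Z" and S: "S \<in> sets A"
    and g: "g \<in> borel_measurable B" and bounded: "\<And>z. z \<in> space B \<Longrightarrow> \<bar>g z\<bar> \<le> (1::real)"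
  shows "expectation (\<lambda>\<omega>. g (Z \<omega>) * indicator S (X \<omega>)) =
    expectation (\<lambda>\<omega>. g (Z \<omega>)) * prob {\<omega>\<in>space M. X \<omega> \<in> S}"
proof -
  have X: "X \<in> M \<rightarrow>\<^sub>M A" and Z: "Z \<in> M \<rightarrow>\<^sub>M B"
    and set: "indep_set (sets (vimage_algebra (space M) X A)) (sets (vimage_algebra (space M) Z B))"
    using ind by (auto simp: independent_def)
  have X'[measurable]: "(\<lambda>\<omega>. indicator S (X \<omega>) :: real) \<in> borel_measurable M"
    using X S by measurable
  have Z'[measurable]: "(\<lambda>\<omega>. g (Z \<omega>)) \<in> borel_measurable M"
    using Z g by measurable
  have sub: "sigma_sets (space M) {f -` a \<inter> space M | a. a \<in> sets (borel :: real measure)} \<subseteq> sets N"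
    if "f \<in> borel_measurable N" "space N = space M" for f :: "'a \<Rightarrow> real" and N
  proof -
    have "{f -` a \<inter> space M | a. a \<in> sets (borel :: real measure)} \<subseteq> sets N"
      using measurable_sets[OF that(1)] that(2) by auto
    from sets.sigma_sets_subset[OF this] that(2) show ?thesis by simp
  qed
  have Xv: "X \<in> vimage_algebra (space M) X A \<rightarrow>\<^sub>M A" and Zv: "Z \<in> vimage_algebra (space M) Z B \<rightarrow>\<^sub>M B"
    using measurable_space[OF X] measurable_space[OF Z] by (auto intro!: measurable_vimage_algebra1)
  have "(\<lambda>\<omega>. indicator S (X \<omega>) :: real) \<in> borel_measurable (vimage_algebra (space M) X A)"
    using Xv S by measurable
  from sub[OF this] have subX:
    "sigma_sets (space M) {(\<lambda>\<omega>. indicator S (X \<omega>) :: real) -` a \<inter> space M | a. a \<in> sets borel}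
      \<subseteq> sets (vimage_algebra (space M) X A)" by simp
  have "(\<lambda>\<omega>. g (Z \<omega>)) \<in> borel_measurable (vimage_algebra (space M) Z B)"
    using Zv g by measurable
  from sub[OF this] have subZ:
    "sigma_sets (space M) {(\<lambda>\<omega>. g (Z \<omega>)) -` a \<inter> space M | a. a \<in> sets borel}
      \<subseteq> sets (vimage_algebra (space M) Z B)" by simp
  have "indep_set
      (sigma_sets (space M) {(\<lambda>\<omega>. indicator S (X \<omega>) :: real) -` a \<inter> space M | a. a \<in> sets borel})
      (sigma_sets (space M) {(\<lambda>\<omega>. g (Z \<omega>)) -` a \<inter> space M | a. a \<in> sets borel})"
    unfolding indep_set_def
    by (rule indep_sets_mono_sets[OF set[unfolded indep_set_def]]) (use subX subZ in \<open>simp split: bool.split\<close>)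
  hence indep: "indep_var borel (\<lambda>\<omega>. indicator S (X \<omega>) :: real) borel (\<lambda>\<omega>. g (Z \<omega>))"
    unfolding indep_var_eq using X' Z' by blast
  have gi: "integrable M (\<lambda>\<omega>. g (Z \<omega>))"
    using bounded measurable_space[OF Z] by (intro integrable_const_bound[of _ 1]) auto
  have Si: "integrable M (\<lambda>\<omega>. indicator S (X \<omega>) :: real)"
    by (intro integrable_const_bound[of _ 1] X') (simp add: indicator_def)
  have "expectation (\<lambda>\<omega>. g (Z \<omega>) * indicator S (X \<omega>)) =
     expectation (\<lambda>\<omega>. g (Z \<omega>)) * expectation (\<lambda>\<omega>. indicator S (X \<omega>))"
    using indep_var_lebesgue_integral[OF indep Si gi] by (simp add: mult.commute)
  also have "expectation (\<lambda>\<omega>. indicator S (X \<omega>)) = prob {\<omega>\<in>space M. X \<omega> \<in> S}"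
  proof -
    have "expectation (\<lambda>\<omega>. indicator S (X \<omega>)) = expectation (indicator {\<omega>\<in>space M. X \<omega> \<in> S})"
      by (intro Bochner_Integration.integral_cong) (auto simp: indicator_def)
    also have "\<dots> = prob {\<omega>\<in>space M. X \<omega> \<in> S}"
      by (auto intro!: arg_cong[where f=prob])
    finally show ?thesis .
  qed
  finally show ?thesis .
qed

text \<open>
  Continuity from above along \<open>1/(n+1)\<close>. All smaller thresholds are included so that the thresholds
  of two variables can be replaced by their minimum.
\<close>

lemma (in prob_space) positive_rv_small_values_unlikely:
  fixes X :: "'a \<Rightarrow> ereal"
  assumes X[measurable]: "X \<in> borel_measurable M" and pos: "prob {\<omega>\<in>space M. X \<omega> \<le> 0} = 0"
    and p: "0 < p"
  shows "\<exists>e>0. \<forall>e'\<le>e. prob {\<omega>\<in>space M. X \<omega> \<le> ereal e'} \<le> p"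
proof -
  define A where "A n = {\<omega>\<in>space M. X \<omega> \<le> ereal (1 / real (Suc n))}" for n
  have A: "A n \<in> events" for n
    unfolding A_def by measurable
  have dec: "decseq A"
    unfolding A_def decseq_def
    by (auto intro: order_trans simp: frac_le)
  have "(\<Inter>n. A n) = {\<omega>\<in>space M. X \<omega> \<le> 0}"
  proof (intro equalityI subsetI)
    fix \<omega> assume *: "\<omega> \<in> (\<Inter>n. A n)"
    have lim: "(\<lambda>n. ereal (1 / real (Suc n))) \<longlonglongrightarrow> ereal 0"
      using LIMSEQ_inverse_real_of_nat by (intro tendsto_ereal) (simp add: inverse_eq_divide)
    have "X \<omega> \<le> ereal (1 / real (Suc n))" for n
      using * by (auto simp: A_def)
    hence "X \<omega> \<le> ereal 0"
      by (intro LIMSEQ_le_const[OF lim]) blast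
    with * show "\<omega> \<in> {\<omega>\<in>space M. X \<omega> \<le> 0}"
      by (auto simp: A_def zero_ereal_def)
  next
    fix \<omega> assume "\<omega> \<in> {\<omega>\<in>space M. X \<omega> \<le> 0}"
    thus "\<omega> \<in> (\<Inter>n. A n)"
      by (auto simp: A_def intro: order_trans)
  qed
  hence "(\<lambda>n. prob (A n)) \<longlonglongrightarrow> 0"
    using finite_Lim_measure_decseq[of A] A dec pos by auto
  from order_tendstoD(2)[OF this p] obtain n where n: "prob (A n) < p"
    by (auto simp: eventually_sequentially)
  have "prob {\<omega>\<in>space M. X \<omega> \<le> ereal e'} \<le> p" if "e' \<le> 1 / real (Suc n)" for e'
  proof -
    have "{\<omega>\<in>space M. X \<omega> \<le> ereal e'} \<subseteq> A n"
      using that by (auto simp: A_def intro: order_trans[of _ "ereal e'"])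
    from finite_measure_mono[OF this A] n show ?thesis by simp
  qed
  thus ?thesis
    by (intro exI[of _ "1 / real (Suc n)"]) auto
qed

section \<open>Renewals are rare\<close>

text \<open>
  A renewal gap is the minimum of \<open>Y\<close> and \<open>D\<close> for kind \<open>R2\<close>, and at least \<open>Y\<close> for the other kinds.
  The flag \<open>b\<close> says whether a small \<open>D\<close> can make the gap short.
\<close>

definition short_gap :: "bool \<Rightarrow> real \<Rightarrow> (nat \<Rightarrow> real) \<Rightarrow> (nat \<Rightarrow> ereal) \<Rightarrow> nat \<Rightarrow> bool" where
  "short_gap b e y d k \<longleftrightarrow> y k \<le> e \<or> b \<and> d k \<le> ereal e"

text \<open>
  Every long gap halves the weight, so a small mean weight says that many of the first \<open>n\<close> gaps are
  probably long. Being bounded, it always has a finite mean.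
\<close>

definition gap_weight :: "bool \<Rightarrow> real \<Rightarrow> (nat \<Rightarrow> real) \<Rightarrow> (nat \<Rightarrow> ereal) \<Rightarrow> nat \<Rightarrow> real" where
  "gap_weight b e y d n = (\<Prod>k<n. if short_gap b e y d k then 1 else 1 / 2)"

lemma gap_weight_nonneg: "0 \<le> gap_weight b e y d n"
  and gap_weight_le_1: "gap_weight b e y d n \<le> 1"
  by (auto simp: gap_weight_def intro!: prod_nonneg prod_le_1)

lemma gap_weight_eq_power:
  "gap_weight b e y d n = (1 / 2) ^ card {k. k < n \<and> \<not> short_gap b e y d k}"
proof -
  have "{..<n} \<inter> - {k. short_gap b e y d k} = {k. k < n \<and> \<not> short_gap b e y d k}"
    by auto
  thus ?thesis
    unfolding gap_weight_def by (simp add: prod.If_cases)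
qed

text \<open>
  Whatever the kind, passing from one renewal to the next takes time at least \<open>e\<close> if the gap is long.
  For \<open>R3\<close> this holds because the maximum defining the next renewal time is at least its \<open>Y\<close> part.
\<close>

lemma renewal_time_ge_long_gaps:
  assumes y: "\<And>k. 0 < y k" and d: "\<And>k. i = R2 \<Longrightarrow> 0 \<le> d k" and e: "0 \<le> e"
  shows "ereal (e * real (card {k. k < n \<and> \<not> short_gap (i = R2) e y d k})) \<le> renewal_time i y d n"
proof (induction n)
  case 0
  show ?case by (simp add: zero_ereal_def)
next
  case (Suc n)
  define c where "c = e * real (card {k. k < n \<and> \<not> short_gap (i = R2) e y d k})"
  define g where "g = (if short_gap (i = R2) e y d n then 0 else e)"
  have "{k. k < Suc n \<and> \<not> short_gap (i = R2) e y d k} =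
      (if short_gap (i = R2) e y d n then {} else {n}) \<union> {k. k < n \<and> \<not> short_gap (i = R2) e y d k}"
    by (auto simp: less_Suc_eq)
  hence *: "e * real (card {k. k < Suc n \<and> \<not> short_gap (i = R2) e y d k}) = c + g"
    by (simp add: c_def g_def algebra_simps)
  have gy: "ereal g \<le> ereal (y n)"
    using y[of n] e by (auto simp: g_def short_gap_def)
  have gd: "ereal g \<le> d n" if "i = R2"
    using d[OF that, of n] e that by (auto simp: g_def short_gap_def zero_ereal_def)
  have "ereal g + ereal c \<le> ereal (y n) + renewal_time i y d n"
    using add_mono[OF gy Suc.IH] by (simp add: c_def)
  moreover have "ereal c + ereal g \<le> renewal_time i y d n + d n" if "i = R2"
    using add_mono[OF Suc.IH gd[OF that]] that by (simp add: c_def)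
  ultimately have "ereal (c + g) \<le> renewal_time i y d (Suc n)"
    by (cases i) (simp_all add: Let_def add.commute le_max_iff_disj)
  thus ?case by (simp only: *)
qed

locale renewal_hawkes_process = prob_space M for M :: "'a measure" +
  fixes i :: renewal_kind and \<mu> h F f :: "real \<Rightarrow> real" and \<eta> :: real
    and P :: "'a \<Rightarrow> real set" and Y :: "nat \<Rightarrow> 'a \<Rightarrow> real" and D :: "nat \<Rightarrow> 'a \<Rightarrow> ereal"
  assumes mu_pos: "\<forall>t\<ge>0. 0 < \<mu> t" and mu_int: "\<forall>t. set_integrable lborel {0..t} \<mu>"
    and eta: "0 < \<eta>"
    and h_pos: "\<forall>t\<ge>0. 0 < h t" and h_bounded: "\<forall>t. bounded (h ` {0..t})"
    and process: "renewal_hawkes M i \<mu> \<eta> h F f P Y D"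
begin

abbreviation renewal :: "renewal_kind \<Rightarrow> nat \<Rightarrow> 'a \<Rightarrow> ereal" where
  "renewal i' j \<omega> \<equiv> renewal_time i' (\<lambda>k. Y k \<omega>) (\<lambda>k. D k \<omega>) j"

lemma
  shows simple: "simple_point_process M P"
    and Y_indep_vars: "indep_vars (\<lambda>_. borel) Y UNIV"
    and Y_cdf: "prob {\<omega>\<in>space M. Y j \<omega> \<le> t} = F t"
    and Y_pos: "\<omega> \<in> space M \<Longrightarrow> 0 < Y j \<omega>"
    and Y_indep: "independent M borel (Y j) (past_space j) (past P Y D (renewal i) j)"
    and D_cdf: "i \<noteq> R1 \<Longrightarrow> 0 \<le> t \<Longrightarrow> prob {\<omega>\<in>space M. D j \<omega> \<le> ereal t} = immigration_cdf \<mu> t"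
    and D_indep: "i \<noteq> R1 \<Longrightarrow> independent M borel (D j) (past_space j \<Otimes>\<^sub>M borel)
                  (\<lambda>\<omega>. (past P Y D (renewal i) j \<omega>, Y j \<omega>))"
    and intensity: "has_intensity M (rh_history M P (renewal i)) P
          (\<lambda>t \<omega>. rh_intensity \<mu> \<eta> h (P \<omega>) (\<lambda>j. renewal i j \<omega>) t)"
  using process by (simp_all add: renewal_hawkes_def Let_def)

lemma Y_measurable[measurable]: "Y j \<in> borel_measurable M"
  using Y_indep[of j] by (simp add: independent_def)

text \<open>
  For \<open>R1\<close> no measurability of \<open>D\<close> is assumed directly; it is implicit in the measurability of the past.
\<close>

lemma D_measurable[measurable]: "D j \<in> borel_measurable M"
proof -
  have "past P Y D (renewal i) (Suc j) \<in> M \<rightarrow>\<^sub>M past_space (Suc j)"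
    using Y_indep[of "Suc j"] by (simp add: independent_def)
  hence "(\<lambda>\<omega>. snd (snd (past P Y D (renewal i) (Suc j) \<omega>))) \<in> M \<rightarrow>\<^sub>M (\<Pi>\<^sub>M k\<in>{..<Suc j}. borel)"
    unfolding past_space_def by measurable
  hence "(\<lambda>\<omega>. snd (snd (past P Y D (renewal i) (Suc j) \<omega>)) j) \<in> borel_measurable M"
    by (rule measurable_component_singleton[THEN measurable_compose_rev, rotated]) simp
  thus ?thesis by (simp add: past_def)
qed

lemma renewal_measurable[measurable]: "renewal i' j \<in> borel_measurable M"
  by (induction j) (cases i'; simp add: Let_def)+

lemma D_nonpos_null:
  assumes "i \<noteq> R1"
  shows "prob {\<omega>\<in>space M. D j \<omega> \<le> 0} = 0"
proof -
  have "(LBINT v:{0..0}. \<mu> v) = 0"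
    unfolding set_lebesgue_integral_def
    by (intro integral_eq_zero_AE eventually_mono[OF AE_lborel_singleton[of 0]]) (auto simp: indicator_def)
  thus ?thesis
    using D_cdf[OF assms, of 0 j] by (simp add: immigration_cdf_def zero_ereal_def)
qed

lemma AE_D_pos:
  assumes "i \<noteq> R1"
  shows "AE \<omega> in M. \<forall>j. 0 < D j \<omega>"
proof (rule AE_all_countable[THEN iffD2, rule_format])
  fix j
  have "AE \<omega> in M. \<not> (D j \<omega> \<le> 0)"
    using D_nonpos_null[OF assms, of j] by (intro AE_I'[of "{\<omega>\<in>space M. D j \<omega> \<le> 0}"])
      (auto simp: null_sets_def emeasure_eq_measure)
  thus "AE \<omega> in M. 0 < D j \<omega>" by (simp add: not_le)
qed

text \<open>
  Neither waiting time has an atom at \<open>0\<close>: \<open>Y\<close> is positive and the immigration distribution function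
  vanishes at \<open>0\<close>. The threshold serves all gaps at once since their laws do not depend on the index.
\<close>

lemma gap_threshold:
  obtains e where "0 < e" "\<And>j. prob {\<omega>\<in>space M. Y j \<omega> \<le> e} \<le> 1 / 4"
    "\<And>j. i \<noteq> R1 \<Longrightarrow> prob {\<omega>\<in>space M. D j \<omega> \<le> ereal e} \<le> 1 / 4"
proof -
  have "{\<omega>\<in>space M. ereal (Y 0 \<omega>) \<le> 0} = {}"
    using Y_pos[of _ 0] by (auto simp: zero_ereal_def not_le)
  hence "prob {\<omega>\<in>space M. ereal (Y 0 \<omega>) \<le> 0} = 0"
    by (simp only:) simp
  from positive_rv_small_values_unlikely[OF _ this, of "1 / 4"]
  obtain e1 where e1: "e1 > 0" "\<And>e'. e' \<le> e1 \<Longrightarrow> prob {\<omega>\<in>space M. Y 0 \<omega> \<le> e'} \<le> 1 / 4"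
    by (auto simp del: ereal_less_eq(5))
  have "\<exists>e2>0. i \<noteq> R1 \<longrightarrow> (\<forall>e'\<le>e2. prob {\<omega>\<in>space M. D 0 \<omega> \<le> ereal e'} \<le> 1 / 4)"
    using positive_rv_small_values_unlikely[of "D 0" "1/4"] D_nonpos_null[of 0]
    by (cases "i = R1") (auto intro: exI[of _ 1])
  then obtain e2 where e2: "e2 > 0" "\<And>e'. i \<noteq> R1 \<Longrightarrow> e' \<le> e2 \<Longrightarrow> prob {\<omega>\<in>space M. D 0 \<omega> \<le> ereal e'} \<le> 1 / 4"
    by auto
  show ?thesis
  proof (rule that[of "min e1 e2"])
    show "0 < min e1 e2" using e1 e2 by simp
    show "prob {\<omega>\<in>space M. Y j \<omega> \<le> min e1 e2} \<le> 1 / 4" for j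
      using e1(2)[of "min e1 e2"] unfolding Y_cdf by simp
    show "prob {\<omega>\<in>space M. D j \<omega> \<le> ereal (min e1 e2)} \<le> 1 / 4" if "i \<noteq> R1" for j
      using e2(2)[OF that, of "min e1 e2"] D_cdf[OF that, of "min e1 e2"] e1(1) e2(1) by simp
  qed
qed

lemma short_gap_measurable[measurable]:
  "Measurable.pred M (\<lambda>\<omega>. short_gap b e (\<lambda>k. Y k \<omega>) (\<lambda>k. D k \<omega>) k)"
  unfolding short_gap_def by measurable

lemma gap_weight_measurable[measurable]:
  "(\<lambda>\<omega>. gap_weight b e (\<lambda>k. Y k \<omega>) (\<lambda>k. D k \<omega>) n) \<in> borel_measurable M"
  unfolding gap_weight_def by measurable

text \<open>
  The weight of the first \<open>n\<close> gaps is a function of the past of the \<open>n\<close>-th renewal, hence independent of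
  \<open>Y n\<close> and of \<open>D n\<close>. The next gap halves it except with probability at most \<open>1/4 + 1/4\<close>, so the mean is
  multiplied by at most \<open>1/2 + 1/2 * 1/2 = 3/4\<close>.
\<close>

lemma expected_gap_weight_le:
  assumes e: "\<And>j. prob {\<omega>\<in>space M. Y j \<omega> \<le> e} \<le> 1 / 4"
    "\<And>j. i \<noteq> R1 \<Longrightarrow> prob {\<omega>\<in>space M. D j \<omega> \<le> ereal e} \<le> 1 / 4"
    and b: "b \<Longrightarrow> i \<noteq> R1"
  shows "expectation (\<lambda>\<omega>. gap_weight b e (\<lambda>k. Y k \<omega>) (\<lambda>k. D k \<omega>) n) \<le> (3 / 4) ^ n"
proof (induction n)
  case 0
  show ?case by (simp add: gap_weight_def prob_space)
next
  case (Suc n)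
  define w where "w \<omega> = gap_weight b e (\<lambda>k. Y k \<omega>) (\<lambda>k. D k \<omega>) n" for \<omega>
  define g where "g = (\<lambda>p :: (real \<Rightarrow> nat) \<times> (nat \<Rightarrow> real) \<times> (nat \<Rightarrow> ereal). gap_weight b e (fst (snd p)) (snd (snd p)) n)"
  have w[measurable]: "w \<in> borel_measurable M"
    unfolding w_def by measurable
  have w01: "0 \<le> w \<omega>" "w \<omega> \<le> 1" for \<omega>
    by (auto simp: w_def gap_weight_nonneg gap_weight_le_1)
  have g[measurable]: "g \<in> borel_measurable (past_space n)"
    unfolding g_def gap_weight_def short_gap_def past_space_def by measurable
  have gw: "g (past P Y D (renewal i) n \<omega>) = w \<omega>" for \<omega>
    by (simp add: g_def w_def past_def gap_weight_def short_gap_def)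
  have g1: "\<bar>g p\<bar> \<le> 1" for p
    by (simp add: g_def abs_of_nonneg gap_weight_nonneg gap_weight_le_1)
  define sY where "sY \<omega> = (indicator {..e} (Y n \<omega>) :: real)" for \<omega>
  define sD where "sD \<omega> = (if b then indicator {..ereal e} (D n \<omega>) else 0 :: real)" for \<omega>
  have int: "integrable M w" "integrable M (\<lambda>\<omega>. w \<omega> * sY \<omega>)" "integrable M (\<lambda>\<omega>. w \<omega> * sD \<omega>)"
    using w01 by (auto intro!: integrable_const_bound[of _ 1] simp: sY_def sD_def indicator_def)
  have Ew: "0 \<le> expectation w"
    by (intro Bochner_Integration.integral_nonneg w01)
  have Yn: "expectation (\<lambda>\<omega>. w \<omega> * sY \<omega>) \<le> expectation w * (1 / 4)"
    using independent_expectation[OF Y_indep[of n], where S="{..e}" and g=g] g1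
      mult_left_mono[OF e(1)[of n] Ew] by (simp add: gw sY_def)
  have Dn: "expectation (\<lambda>\<omega>. w \<omega> * sD \<omega>) \<le> expectation w * (1 / 4)"
  proof (cases b)
    case True
    show ?thesis
      using independent_expectation[OF D_indep[OF b[OF True], of n], where S="{..ereal e}" and g="\<lambda>p. g (fst p)"] g1
        mult_left_mono[OF e(2)[OF b[OF True], of n] Ew] by (simp add: gw sD_def True)
  next
    case False
    thus ?thesis by (simp add: sD_def Bochner_Integration.integral_nonneg w01)
  qed
  have "expectation (\<lambda>\<omega>. gap_weight b e (\<lambda>k. Y k \<omega>) (\<lambda>k. D k \<omega>) (Suc n)) \<le>
     expectation (\<lambda>\<omega>. 1 / 2 * w \<omega> + 1 / 2 * (w \<omega> * sY \<omega> + w \<omega> * sD \<omega>))"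
  proof (intro integral_mono)
    show "integrable M (\<lambda>\<omega>. gap_weight b e (\<lambda>k. Y k \<omega>) (\<lambda>k. D k \<omega>) (Suc n))"
      by (intro integrable_const_bound[of _ 1]) (auto simp: abs_of_nonneg gap_weight_nonneg gap_weight_le_1)
    show "integrable M (\<lambda>\<omega>. 1 / 2 * w \<omega> + 1 / 2 * (w \<omega> * sY \<omega> + w \<omega> * sD \<omega>))"
      using int by auto
    fix \<omega>
    have "gap_weight b e (\<lambda>k. Y k \<omega>) (\<lambda>k. D k \<omega>) (Suc n) =
        w \<omega> * (if short_gap b e (\<lambda>k. Y k \<omega>) (\<lambda>k. D k \<omega>) n then 1 else 1 / 2)"
      by (simp add: gap_weight_def w_def)
    also have "\<dots> \<le> w \<omega> * (1 / 2 + 1 / 2 * (sY \<omega> + sD \<omega>))"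
      by (intro mult_left_mono w01) (auto simp: short_gap_def sY_def sD_def indicator_def)
    finally show "gap_weight b e (\<lambda>k. Y k \<omega>) (\<lambda>k. D k \<omega>) (Suc n)
        \<le> 1 / 2 * w \<omega> + 1 / 2 * (w \<omega> * sY \<omega> + w \<omega> * sD \<omega>)"
      by (simp add: algebra_simps add_divide_distrib)
  qed
  also have "\<dots> = 1 / 2 * expectation w + 1 / 2 * (expectation (\<lambda>\<omega>. w \<omega> * sY \<omega>) + expectation (\<lambda>\<omega>. w \<omega> * sD \<omega>))"
    using int by simp
  also have "\<dots> \<le> 3 / 4 * expectation w"
    using Yn Dn by simp
  also have "\<dots> \<le> (3 / 4) ^ Suc n"
    using Suc.IH by (simp add: w_def[abs_def])
  finally show ?case .
qed

text \<open>
  If the \<open>n\<close>-th renewal comes before \<open>t\<close>, at most \<open>t/e\<close> of the first \<open>n\<close> gaps were long, which keeps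
  the weight above a constant; Markov's inequality concludes. The kind \<open>i'\<close> may differ from that of the
  process: with \<open>i' = R1\<close> the renewal times are the partial sums of \<open>Y\<close>, that is, the environmental
  changes.
\<close>

lemma early_renewal_exponentially_unlikely:
  assumes i': "i' = R2 \<Longrightarrow> i \<noteq> R1"
  shows "\<exists>C. \<forall>n. prob {\<omega>\<in>space M. renewal i' n \<omega> < ereal t} \<le> C * (3 / 4) ^ n"
proof -
  from gap_threshold obtain e where e: "0 < e" "\<And>j. prob {\<omega>\<in>space M. Y j \<omega> \<le> e} \<le> 1 / 4"
    "\<And>j. i \<noteq> R1 \<Longrightarrow> prob {\<omega>\<in>space M. D j \<omega> \<le> ereal e} \<le> 1 / 4" by blast
  define w where "w n \<omega> = gap_weight (i' = R2) e (\<lambda>k. Y k \<omega>) (\<lambda>k. D k \<omega>) n" for n \<omega>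
  have w[measurable]: "w n \<in> borel_measurable M" for n
    unfolding w_def by measurable
  \<comment> \<open>An upper bound for the number of long gaps before time \<open>t\<close>.\<close>
  define m where "m = nat \<lceil>t / e\<rceil>"
  have AE: "AE \<omega> in M. i' = R2 \<longrightarrow> (\<forall>j. 0 < D j \<omega>)"
    using AE_D_pos i' by (cases "i' = R2") auto
  have "prob {\<omega>\<in>space M. renewal i' n \<omega> < ereal t} \<le> 2 ^ m * (3 / 4) ^ n" for n
  proof -
    have "prob {\<omega>\<in>space M. renewal i' n \<omega> < ereal t} \<le> prob {\<omega>\<in>space M. (1 / 2) ^ m \<le> w n \<omega>}"
    proof (rule finite_measure_mono_AE)
      show "AE \<omega> in M. \<omega> \<in> {\<omega>\<in>space M. renewal i' n \<omega> < ereal t} \<longrightarrow> \<omega> \<in> {\<omega>\<in>space M. (1 / 2) ^ m \<le> w n \<omega>}"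
        using AE AE_space
      proof eventually_elim
        fix \<omega> assume *: "i' = R2 \<longrightarrow> (\<forall>j. 0 < D j \<omega>)" "\<omega> \<in> space M"
        show "\<omega> \<in> {\<omega>\<in>space M. renewal i' n \<omega> < ereal t} \<longrightarrow> \<omega> \<in> {\<omega>\<in>space M. (1 / 2) ^ m \<le> w n \<omega>}"
        proof safe
          assume "renewal i' n \<omega> < ereal t"
          define c where "c = card {k. k < n \<and> \<not> short_gap (i' = R2) e (\<lambda>k. Y k \<omega>) (\<lambda>k. D k \<omega>) k}"
          have "ereal (e * real c) \<le> renewal i' n \<omega>"
            unfolding c_def using * Y_pos e(1) by (intro renewal_time_ge_long_gaps) (auto intro: less_imp_le)
          also note \<open>renewal i' n \<omega> < ereal t\<close>
          finally have "real c < t / e"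
            using e(1) by (simp add: pos_less_divide_eq mult.commute)
          hence "c \<le> m"
            by (simp add: m_def) linarith
          thus "(1 / 2) ^ m \<le> w n \<omega>"
            unfolding w_def gap_weight_eq_power c_def[symmetric] by (intro power_decreasing) auto
        qed
      qed
    qed measurable
    also have "\<dots> \<le> expectation (w n) / (1 / 2) ^ m"
      by (intro integral_Markov_inequality_measure[of _ _ "{}"])
         (auto simp: w_def gap_weight_nonneg gap_weight_le_1 abs_of_nonneg intro!: integrable_const_bound[of _ 1])
    also have "\<dots> \<le> (3 / 4) ^ n / (1 / 2) ^ m"
      unfolding w_def using i' by (intro divide_right_mono expected_gap_weight_le[OF e(2,3)]) auto
    finally show ?thesis by (simp add: power_one_over field_simps)
  qed
  thus ?thesis by blast
qed

lemma expected_number_of_renewals_finite: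
  assumes i': "i' = R2 \<Longrightarrow> i \<noteq> R1"
  shows "(\<integral>\<^sup>+\<omega>. (\<Sum>n. indicator {..<ereal t} (renewal i' n \<omega>)) \<partial>M) < \<infinity>"
proof -
  from early_renewal_exponentially_unlikely[OF i', where t=t]
  obtain C where C: "\<And>n. prob {\<omega>\<in>space M. renewal i' n \<omega> < ereal t} \<le> C * (3 / 4) ^ n" by blast
  have C0: "0 \<le> C"
    using order_trans[OF measure_nonneg C[of 0]] by simp
  have "(\<integral>\<^sup>+\<omega>. (\<Sum>n. indicator {..<ereal t} (renewal i' n \<omega>)) \<partial>M) =
    (\<Sum>n. \<integral>\<^sup>+\<omega>. indicator {..<ereal t} (renewal i' n \<omega>) \<partial>M)"
    by (intro nn_integral_suminf) measurable
  also have "\<dots> = (\<Sum>n. \<integral>\<^sup>+\<omega>. indicator {\<omega>\<in>space M. renewal i' n \<omega> < ereal t} \<omega> \<partial>M)"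
    by (intro suminf_cong nn_integral_cong) (auto simp: indicator_def)
  also have "\<dots> = (\<Sum>n. ennreal (prob {\<omega>\<in>space M. renewal i' n \<omega> < ereal t}))"
    by (simp add: emeasure_eq_measure)
  also have "\<dots> \<le> (\<Sum>n. ennreal (C * (3 / 4) ^ n))"
    by (intro suminf_le ennreal_leI C) auto
  also have "\<dots> = ennreal (\<Sum>n. C * (3 / 4) ^ n)"
    using C0 by (intro suminf_ennreal2 summable_mult summable_geometric) auto
  also have "\<dots> < \<infinity>" by simp
  finally show ?thesis .
qed

end

section \<open>Finite mean number of events\<close>

text \<open>
  The supremum defining the last renewal is attained because only finitely many renewals precede \<open>t\<close>.
\<close>

lemma last_renewal_is_renewal:
  assumes fin: "finite {j. \<tau> j < ereal t}" and \<tau>0: "\<tau> 0 = 0" and t: "0 < t"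
  shows "\<exists>j. \<tau> j = ereal (last_renewal \<tau> t)" "0 \<le> last_renewal \<tau> t" "last_renewal \<tau> t < t"
proof -
  let ?A = "insert 0 {r. r < t \<and> (\<exists>j. \<tau> j = ereal r)}"
  have "{r. r < t \<and> (\<exists>j. \<tau> j = ereal r)} \<subseteq> (\<lambda>j. real_of_ereal (\<tau> j)) ` {j. \<tau> j < ereal t}"
  proof
    fix r assume "r \<in> {r. r < t \<and> (\<exists>j. \<tau> j = ereal r)}"
    then obtain j where "r < t" "\<tau> j = ereal r" by blast
    thus "r \<in> (\<lambda>j. real_of_ereal (\<tau> j)) ` {j. \<tau> j < ereal t}"
      by (intro image_eqI[of _ _ j]) auto
  qed
  hence finA: "finite ?A"
    using finite_subset[OF _ finite_imageI[OF fin]] by simp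
  have eq: "last_renewal \<tau> t = Max ?A"
    unfolding last_renewal_def by (intro cSup_eq_Max finA) auto
  have "Max ?A \<in> ?A"
    by (intro Max_in finA) auto
  thus "\<exists>j. \<tau> j = ereal (last_renewal \<tau> t)" "last_renewal \<tau> t < t"
    using \<tau>0 t by (auto simp: eq zero_ereal_def)
  show "0 \<le> last_renewal \<tau> t"
    unfolding eq by (intro Max_ge finA) auto
qed

definition immigration_rate :: "(real \<Rightarrow> real) \<Rightarrow> real \<Rightarrow> real \<Rightarrow> ennreal" where
  "immigration_rate \<mu> b u = ennreal (indicator {0..b} u * \<mu> u)"

text \<open>
  The time since the last renewal depends on \<open>s\<close> in an awkward way. A sum over all renewals, of which the
  last one is a term, is measurable in \<open>s\<close> and can be integrated term by term.
\<close>

lemma immigration_rate_le_sum_renewals: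
  assumes fin: "finite {j. \<tau> j < ereal b}" and \<tau>0: "\<tau> 0 = 0" and s: "0 < s" "s \<le> b"
  shows "ennreal (\<mu> (s - last_renewal \<tau> s)) \<le>
    (\<Sum>j. indicator {..<ereal b} (\<tau> j) * immigration_rate \<mu> b (s - real_of_ereal (\<tau> j)))"
proof -
  have "{j. \<tau> j < ereal s} \<subseteq> {j. \<tau> j < ereal b}"
    using s by (auto intro: less_le_trans)
  hence fin': "finite {j. \<tau> j < ereal s}"
    using fin finite_subset by blast
  define r where "r = last_renewal \<tau> s"
  from last_renewal_is_renewal[OF fin' \<tau>0 s(1)] obtain j where j: "\<tau> j = ereal r" "0 \<le> r" "r < s"
    by (auto simp: r_def)
  have "ennreal (\<mu> (s - r)) = indicator {..<ereal b} (\<tau> j) * immigration_rate \<mu> b (s - real_of_ereal (\<tau> j))"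
    using j s by (simp add: immigration_rate_def)
  also have "\<dots> \<le> (\<Sum>j. indicator {..<ereal b} (\<tau> j) * immigration_rate \<mu> b (s - real_of_ereal (\<tau> j)))"
    using sum_le_suminf[of "\<lambda>j. indicator {..<ereal b} (\<tau> j) * immigration_rate \<mu> b (s - real_of_ereal (\<tau> j))" "{j}"]
    by (simp del: sum_mult_indicator sum_indicator_mult)
  finally show ?thesis by (simp add: r_def)
qed

text \<open>
  The points \<open>v\<close> with fewer than \<open>n\<close> predecessors are the first \<open>n\<close> points, so \<open>(0,b]\<close> contains
  \<open>min N(b) n\<close> of them; those outside \<open>(a,b]\<close> number at most \<open>N(a)\<close>.
\<close>

lemma min_counting_le:
  assumes fin: "finite (A \<inter> {0<..b})" and fin': "finite (A \<inter> {0<..a})" and a: "0 \<le> a"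
  shows "min (counting A b) n \<le> counting A a + card {v \<in> A \<inter> {a<..b}. card (A \<inter> {0<..<v}) < n}"
proof -
  let ?S = "{v \<in> A \<inter> {0<..b}. card (A \<inter> {0<..<v}) < n}"
  have "min (counting A b) n \<le> card ?S"
  proof (cases "?S = A \<inter> {0<..b}")
    case True
    thus ?thesis by (simp add: counting_def)
  next
    case False
    hence ne: "A \<inter> {0<..b} - ?S \<noteq> {}" by auto
    define w where "w = Min (A \<inter> {0<..b} - ?S)"
    have w: "w \<in> A \<inter> {0<..b} - ?S"
      unfolding w_def using fin ne by (intro Min_in) auto
    have "A \<inter> {0<..<w} \<subseteq> ?S"
    proof
      fix v assume v: "v \<in> A \<inter> {0<..<w}"
      show "v \<in> ?S"
      proof (rule ccontr)
        assume "v \<notin> ?S"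
        with v w have "v \<in> A \<inter> {0<..b} - ?S" by auto
        hence "w \<le> v" unfolding w_def using fin by (intro Min_le) auto
        with v show False by auto
      qed
    qed
    hence "card (A \<inter> {0<..<w}) \<le> card ?S"
      by (intro card_mono) (auto intro: finite_subset[OF _ fin])
    moreover have "n \<le> card (A \<inter> {0<..<w})"
      using w by auto
    ultimately show ?thesis by simp
  qed
  also have "\<dots> \<le> card ((A \<inter> {0<..a}) \<union> {v \<in> A \<inter> {a<..b}. card (A \<inter> {0<..<v}) < n})"
    using fin' a fin by (intro card_mono) (auto intro: finite_subset[OF _ fin])
  also have "\<dots> \<le> counting A a + card {v \<in> A \<inter> {a<..b}. card (A \<inter> {0<..<v}) < n}"
    unfolding counting_def by (rule card_Un_le)
  finally show ?thesis .
qed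

text \<open>
  Finiteness of \<open>x\<close> is what allows the subtraction; it is the reason for truncating the number of
  events below.
\<close>

lemma self_bound_ennreal:
  fixes x c :: ennreal
  assumes "x \<le> c + ennreal (1 / 2) * x" "x < \<infinity>"
  shows "x \<le> 2 * c"
proof (cases c)
  case top
  thus ?thesis by (simp add: ennreal_mult_top)
next
  case (real c')
  obtain x' where x': "x = ennreal x'" "0 \<le> x'"
    using assms(2) by (cases x) auto
  have "ennreal (c' + 1 / 2 * x') = ennreal c' + ennreal (1 / 2 * x')"
    using real x' by (intro ennreal_plus) auto
  also have "ennreal (1 / 2 * x') = ennreal (1 / 2) * ennreal x'"
    using x' by (intro ennreal_mult) auto
  finally have "ennreal x' \<le> ennreal (c' + 1 / 2 * x')"
    using assms(1) real x' by (simp only:)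
  hence "x' \<le> c' + 1 / 2 * x'"
    using real x' by (subst (asm) ennreal_le_iff) auto
  hence "ennreal x' \<le> ennreal (2 * c')"
    by (intro ennreal_leI) simp
  also have "\<dots> = 2 * ennreal c'"
    using real by (simp add: ennreal_mult)
  finally show ?thesis using x' real by simp
qed

text \<open>
  The number of events strictly before \<open>s\<close> is left-continuous in \<open>s\<close>: it reaches \<open>n\<close> iff the number of
  events up to some rational \<open>q < s\<close> does, which is an event of the history at \<open>q\<close>.
\<close>

lemma predictable_count_before:
  assumes fin: "\<And>\<omega> t. \<omega> \<in> \<Omega> \<Longrightarrow> finite (P \<omega> \<inter> {0<..t})"
    and H: "\<And>q. 0 \<le> q \<Longrightarrow> {\<omega>\<in>\<Omega>. n \<le> counting (P \<omega>) q} \<in> sets (H q)"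
    and \<Omega>: "\<And>q. 0 \<le> q \<Longrightarrow> space (H q) = \<Omega>"
    and ab: "0 \<le> a" "a < b"
  shows "{a<..b} \<times> \<Omega> \<inter> {(s, \<omega>). card (P \<omega> \<inter> {0<..<s}) < n} \<in> sets (predictable \<Omega> H)"
proof -
  have sets: "sets (predictable \<Omega> H) = sigma_sets ({0<..} \<times> \<Omega>) {{s<..t} \<times> A | s t A. 0 \<le> s \<and> s < t \<and> A \<in> sets (H s)}"
    unfolding predictable_def
    by (rule sets_measure_of) (use \<Omega> sets.sets_into_space in fastforce)
  have basic: "{s<..t} \<times> A \<in> sets (predictable \<Omega> H)" if "0 \<le> s" "s < t" "A \<in> sets (H s)" for s t A
    unfolding sets using that by blast
  have ray: "{q<..} \<times> A \<in> sets (predictable \<Omega> H)" if "0 \<le> q" "A \<in> sets (H q)" for q A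
  proof -
    have "{q<..} \<times> A = (\<Union>k. {q<..q + real (Suc k)} \<times> A)"
    proof (intro equalityI subsetI)
      fix p assume p: "p \<in> {q<..} \<times> A"
      obtain k where "fst p - q < real k"
        using reals_Archimedean2 by blast
      with p show "p \<in> (\<Union>k. {q<..q + real (Suc k)} \<times> A)"
        by (auto intro!: exI[of _ k])
    qed auto
    thus ?thesis using that by (auto intro!: basic sets.countable_UN)
  qed
  \<comment> \<open>Rationals are used for countability, nonnegative ones because the history starts at \<open>0\<close>.\<close>
  define Q where "Q = {q \<in> \<rat>. (0::real) \<le> q}"
  have "countable Q"
    unfolding Q_def using countable_rat by (auto intro: countable_subset)
  hence "(\<Union>q\<in>Q. {q<..} \<times> {\<omega>\<in>\<Omega>. n \<le> counting (P \<omega>) q}) \<in> sets (predictable \<Omega> H)"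
    using H by (intro sets.countable_UN') (auto simp: Q_def intro!: ray)
  moreover have "\<Omega> \<in> sets (H a)"
    using \<Omega>[OF ab(1)] sets.top[of "H a"] by simp
  hence "{a<..b} \<times> \<Omega> \<in> sets (predictable \<Omega> H)"
    using ab by (intro basic)
  ultimately have "{a<..b} \<times> \<Omega> - (\<Union>q\<in>Q. {q<..} \<times> {\<omega>\<in>\<Omega>. n \<le> counting (P \<omega>) q}) \<in> sets (predictable \<Omega> H)"
    by blast
  also have "{a<..b} \<times> \<Omega> - (\<Union>q\<in>Q. {q<..} \<times> {\<omega>\<in>\<Omega>. n \<le> counting (P \<omega>) q}) =
      {a<..b} \<times> \<Omega> \<inter> {(s, \<omega>). card (P \<omega> \<inter> {0<..<s}) < n}"
  proof -
    have "(\<exists>q\<in>Q. q < s \<and> n \<le> counting (P \<omega>) q) \<longleftrightarrow> n \<le> card (P \<omega> \<inter> {0<..<s})"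
      if \<omega>: "\<omega> \<in> \<Omega>" and s: "a < s" for s \<omega>
    proof
      have fin': "finite (P \<omega> \<inter> {0<..<s})"
        using fin[OF \<omega>, of s] by (rule finite_subset[rotated]) auto
      {
        assume "\<exists>q\<in>Q. q < s \<and> n \<le> counting (P \<omega>) q"
        then obtain q where q: "q < s" "n \<le> card (P \<omega> \<inter> {0<..q})"
          by (auto simp: counting_def)
        have "card (P \<omega> \<inter> {0<..q}) \<le> card (P \<omega> \<inter> {0<..<s})"
          using q by (intro card_mono fin') auto
        with q show "n \<le> card (P \<omega> \<inter> {0<..<s})" by simp
      next
        assume n: "n \<le> card (P \<omega> \<inter> {0<..<s})"
        define w where "w = Max (insert 0 (P \<omega> \<inter> {0<..<s}))"
        have "w \<in> insert 0 (P \<omega> \<inter> {0<..<s})"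
          unfolding w_def using fin' by (intro Max_in) auto
        hence "0 \<le> w" "w < s" using ab s by auto
        obtain q where q: "q \<in> \<rat>" "w < q" "q < s"
          using Rats_dense_in_real[OF \<open>w < s\<close>] by auto
        have "v \<le> w" if "v \<in> P \<omega> \<inter> {0<..<s}" for v
          unfolding w_def using fin' that by (intro Max_ge) auto
        hence "P \<omega> \<inter> {0<..<s} \<subseteq> P \<omega> \<inter> {0<..q}"
          using q by force
        hence "card (P \<omega> \<inter> {0<..<s}) \<le> counting (P \<omega>) q"
          unfolding counting_def by (intro card_mono fin[OF \<omega>])
        thus "\<exists>q\<in>Q. q < s \<and> n \<le> counting (P \<omega>) q"
          using q n \<open>0 \<le> w\<close> by (auto simp: Q_def intro!: bexI[of _ q])
      }
    qed
    hence key: "(\<forall>q\<in>Q. q < s \<longrightarrow> counting (P \<omega>) q < n) \<longleftrightarrow> card (P \<omega> \<inter> {0<..<s}) < n"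
      if "\<omega> \<in> \<Omega>" "a < s" for s \<omega>
      using that by (meson not_less)
    show ?thesis
    proof (rule set_eqI)
      fix p :: "real \<times> 'a"
      show "p \<in> {a<..b} \<times> \<Omega> - (\<Union>q\<in>Q. {q<..} \<times> {\<omega>\<in>\<Omega>. n \<le> counting (P \<omega>) q}) \<longleftrightarrow>
          p \<in> {a<..b} \<times> \<Omega> \<inter> {(s, \<omega>). card (P \<omega> \<inter> {0<..<s}) < n}"
        using key[of "snd p" "fst p"] by (cases p) (simp add: not_le conj_commute cong: conj_cong)
    qed
  qed
  finally show ?thesis .
qed

lemma suminf_indicator_eq_count:
  "(\<Sum>n. indicator A n :: ennreal) = emeasure (count_space UNIV) A"
  by (subst nn_integral_count_space_nat[symmetric]) (simp add: nn_integral_indicator)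

context renewal_hawkes_process
begin

lemma P_locally_finite: "\<omega> \<in> space M \<Longrightarrow> finite (P \<omega> \<inter> {0<..t})"
  and counting_measurable[measurable]: "(\<lambda>\<omega>. counting (P \<omega>) t) \<in> M \<rightarrow>\<^sub>M count_space UNIV"
  using simple by (auto simp: simple_point_process_def)

lemma immigration_rate_measurable[measurable]: "immigration_rate \<mu> b \<in> borel_measurable borel"
  using mu_int[rule_format, of b] unfolding immigration_rate_def[abs_def] set_integrable_def by simp

lemma immigration_rate_integral_finite: "(\<integral>\<^sup>+u. immigration_rate \<mu> b u \<partial>lborel) < \<infinity>"
proof -
  have "(\<integral>\<^sup>+u. immigration_rate \<mu> b u \<partial>lborel) \<le> (\<integral>\<^sup>+u. ennreal (norm (indicator {0..b} u *\<^sub>R \<mu> u)) \<partial>lborel)"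
    by (intro nn_integral_mono) (auto simp: immigration_rate_def intro!: ennreal_leI)
  also have "\<dots> < \<infinity>"
    using mu_int[rule_format, of b] by (simp add: set_integrable_def integrable_iff_bounded)
  finally show ?thesis .
qed

text \<open>
  By translation invariance every renewal before \<open>b\<close> contributes the same integral of the immigration
  rate.
\<close>

lemma integral_sum_renewals:
  "(\<integral>\<^sup>+s. (\<Sum>j. indicator {..<ereal b} (\<tau> j) * immigration_rate \<mu> b (s - real_of_ereal (\<tau> j))) \<partial>lborel) =
    (\<integral>\<^sup>+u. immigration_rate \<mu> b u \<partial>lborel) * (\<Sum>j. indicator {..<ereal b} (\<tau> j))"
proof -
  have shift: "(\<integral>\<^sup>+s. immigration_rate \<mu> b (s - r) \<partial>lborel) = (\<integral>\<^sup>+u. immigration_rate \<mu> b u \<partial>lborel)" for r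
    by (subst (2) nn_integral_real_affine[of _ 1 "- r"]) auto
  show ?thesis
    by (simp add: nn_integral_suminf nn_integral_cmult shift mult.commute)
qed

text \<open>
  On a single path, the integrated intensity over \<open>(a,b]\<close>, stopped once \<open>n\<close> events have occurred, has two
  parts. Immigration contributes at most the integral of \<open>\<mu>\<close> over \<open>[0,b]\<close> once per renewal. Excitation
  contributes at most \<open>\<eta> B\<close> per past event and unit of time, and the stopping keeps the number of
  past events below \<open>n\<close>.
\<close>

lemma compensator_le:
  assumes \<omega>: "\<omega> \<in> space M" and fin: "finite {j. renewal i j \<omega> < ereal b}"
    and ab: "0 \<le> a" "a \<le> b" and B: "\<And>u. u \<in> {0..b} \<Longrightarrow> h u \<le> B" "0 \<le> B"
  shows "(\<integral>\<^sup>+s\<in>{0<..}. indicator ({a<..b} \<times> space M \<inter> {(s, \<omega>). card (P \<omega> \<inter> {0<..<s}) < n}) (s, \<omega>) *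
      ennreal (rh_intensity \<mu> \<eta> h (P \<omega>) (\<lambda>j. renewal i j \<omega>) s) \<partial>lborel)
    \<le> (\<integral>\<^sup>+u. immigration_rate \<mu> b u \<partial>lborel) * (\<Sum>j. indicator {..<ereal b} (renewal i j \<omega>)) +
      ennreal (\<eta> * B * (b - a)) * of_nat (min (counting (P \<omega>) b) n)"
proof -
  define k where "k = min (counting (P \<omega>) b) n"
  let ?I = "\<lambda>s. (\<Sum>j. indicator {..<ereal b} (renewal i j \<omega>) * immigration_rate \<mu> b (s - real_of_ereal (renewal i j \<omega>)))"
  have "(\<integral>\<^sup>+s\<in>{0<..}. indicator ({a<..b} \<times> space M \<inter> {(s, \<omega>). card (P \<omega> \<inter> {0<..<s}) < n}) (s, \<omega>) *
      ennreal (rh_intensity \<mu> \<eta> h (P \<omega>) (\<lambda>j. renewal i j \<omega>) s) \<partial>lborel)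
    \<le> (\<integral>\<^sup>+s. ?I s + ennreal (\<eta> * B) * of_nat k * indicator {a<..b} s \<partial>lborel)"
  proof (rule nn_integral_mono)
    fix s :: real
    show "indicator ({a<..b} \<times> space M \<inter> {(s, \<omega>). card (P \<omega> \<inter> {0<..<s}) < n}) (s, \<omega>) *
        ennreal (rh_intensity \<mu> \<eta> h (P \<omega>) (\<lambda>j. renewal i j \<omega>) s) * indicator {0<..} s
      \<le> ?I s + ennreal (\<eta> * B) * of_nat k * indicator {a<..b} s"
    proof (cases "a < s \<and> s \<le> b \<and> card (P \<omega> \<inter> {0<..<s}) < n")
      case True
      hence s: "0 < s" "s \<le> b" using ab by auto
      have R: "last_renewal (\<lambda>j. renewal i j \<omega>) s < s"
      proof (rule last_renewal_is_renewal)
        show "finite {j. renewal i j \<omega> < ereal s}"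
          using s by (intro finite_subset[OF _ fin]) (auto intro: less_le_trans)
      qed (use s in auto)
      have "card (P \<omega> \<inter> {0<..<s}) \<le> counting (P \<omega>) b"
        unfolding counting_def using s by (intro card_mono P_locally_finite \<omega>) auto
      with True have card: "card (P \<omega> \<inter> {0<..<s}) \<le> k" by (simp add: k_def)
      have "(\<Sum>v\<in>P \<omega> \<inter> {0<..<s}. h (s - v)) \<le> (\<Sum>v\<in>P \<omega> \<inter> {0<..<s}. B)"
        using s by (intro sum_mono B) auto
      also have "\<dots> \<le> real k * B"
        using card B(2) by (simp add: mult_right_mono)
      finally have "\<eta> * (\<Sum>v\<in>P \<omega> \<inter> {0<..<s}. h (s - v)) \<le> \<eta> * B * real k"
        using eta mult_left_mono[of _ _ \<eta>] by (fastforce simp: ac_simps)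
      hence "ennreal (rh_intensity \<mu> \<eta> h (P \<omega>) (\<lambda>j. renewal i j \<omega>) s) \<le>
          ennreal (\<mu> (s - last_renewal (\<lambda>j. renewal i j \<omega>) s) + \<eta> * B * real k)"
        unfolding rh_intensity_def by (intro ennreal_leI) simp
      also have "\<dots> = ennreal (\<mu> (s - last_renewal (\<lambda>j. renewal i j \<omega>) s)) + ennreal (\<eta> * B) * of_nat k"
        using eta B(2) mu_pos R
        by (subst ennreal_plus) (auto simp: ennreal_mult ennreal_of_nat_eq_real_of_nat less_imp_le)
      also have "\<dots> \<le> ?I s + ennreal (\<eta> * B) * of_nat k"
        by (intro add_mono immigration_rate_le_sum_renewals fin s) auto
      finally show ?thesis
        using True s \<omega> by simp
    qed (auto simp: indicator_def)
  qed
  also have "\<dots> = (\<integral>\<^sup>+u. immigration_rate \<mu> b u \<partial>lborel) * (\<Sum>j. indicator {..<ereal b} (renewal i j \<omega>)) +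
      ennreal (\<eta> * B) * of_nat k * ennreal (b - a)"
    using ab by (subst nn_integral_add) (auto simp: integral_sum_renewals nn_integral_cmult_indicator)
  also have "ennreal (\<eta> * B) * of_nat k * ennreal (b - a) = ennreal (\<eta> * B * (b - a)) * of_nat k"
    using eta B(2) ab by (simp add: ennreal_mult ac_simps)
  finally show ?thesis by (simp add: k_def)
qed

lemma history_space: "space (rh_history M P (renewal i) q) = space M"
  unfolding rh_history_def by (rule space_measure_of) auto

lemma counting_history: "0 \<le> q \<Longrightarrow> {\<omega>\<in>space M. n \<le> counting (P \<omega>) q} \<in> sets (rh_history M P (renewal i) q)"
proof -
  assume q: "0 \<le> q"
  have sets: "sets (rh_history M P (renewal i) q) = sigma_sets (space M)
     ({{\<omega>\<in>space M. counting (P \<omega>) s = n} | s n. 0 \<le> s \<and> s \<le> q} \<union>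
      {{\<omega>\<in>space M. renewal i j \<omega> \<le> ereal s} | j s. 0 \<le> s \<and> s \<le> q})"
    unfolding rh_history_def by (rule sets_measure_of) auto
  have "{\<omega>\<in>space M. counting (P \<omega>) q = m} \<in> sets (rh_history M P (renewal i) q)" for m
    unfolding sets using q by (intro sigma_sets.Basic) auto
  hence "(\<Union>m\<in>{n..}. {\<omega>\<in>space M. counting (P \<omega>) q = m}) \<in> sets (rh_history M P (renewal i) q)"
    by (intro sets.countable_UN') auto
  also have "(\<Union>m\<in>{n..}. {\<omega>\<in>space M. counting (P \<omega>) q = m}) = {\<omega>\<in>space M. n \<le> counting (P \<omega>) q}"
    by auto
  finally show ?thesis .
qed

text \<open>
  A sum of indicators with finite mean is almost surely finite.
\<close>

lemma AE_finite_renewals: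
  assumes "i' = R2 \<Longrightarrow> i \<noteq> R1"
  shows "AE \<omega> in M. finite {j. renewal i' j \<omega> < ereal t}"
proof -
  have "AE \<omega> in M. (\<Sum>n. indicator {..<ereal t} (renewal i' n \<omega>) :: ennreal) \<noteq> \<infinity>"
  proof (rule nn_integral_PInf_AE)
    show "(\<integral>\<^sup>+\<omega>. (\<Sum>n. indicator {..<ereal t} (renewal i' n \<omega>)) \<partial>M) \<noteq> \<infinity>"
      using expected_number_of_renewals_finite[OF assms] by (simp add: less_top)
  qed measurable
  thus ?thesis
  proof eventually_elim
    case (elim \<omega>)
    have "(\<Sum>n. indicator {..<ereal t} (renewal i' n \<omega>)) =
        emeasure (count_space UNIV) {j. renewal i' j \<omega> < ereal t}"
      unfolding suminf_indicator_eq_count[symmetric] by (intro suminf_cong) (auto simp: indicator_def)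
    thus ?case
      using elim by (auto simp: emeasure_count_space split: if_splits)
  qed
qed

text \<open>
  Integrating the predictable indicator of ``fewer than \<open>n\<close> events so far'' over \<open>(a,b]\<close> bounds
  \<open>x = E (min N(b) n)\<close> by a constant plus \<open>\<eta> B (b - a) x\<close>. On a short interval the last term is at most
  \<open>x/2\<close> and can be absorbed, and the resulting bound does not depend on \<open>n\<close>.
\<close>

lemma expected_events_finite_step:
  assumes ab: "0 \<le> a" "a < b" and B: "\<And>u. u \<in> {0..b} \<Longrightarrow> h u \<le> B" "0 \<le> B"
    and small: "\<eta> * B * (b - a) \<le> 1 / 2"
    and fin: "(\<integral>\<^sup>+\<omega>. of_nat (counting (P \<omega>) a) \<partial>M) < \<infinity>"
  shows "(\<integral>\<^sup>+\<omega>. of_nat (counting (P \<omega>) b) \<partial>M) < \<infinity>"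
proof -
  define I where "I = (\<integral>\<^sup>+u. immigration_rate \<mu> b u \<partial>lborel) *
    (\<integral>\<^sup>+\<omega>. (\<Sum>j. indicator {..<ereal b} (renewal i j \<omega>)) \<partial>M)"
  have I: "I < \<infinity>"
    unfolding I_def using immigration_rate_integral_finite[of b] expected_number_of_renewals_finite[of i b]
    by (simp add: ennreal_mult_less_top)
  define c where "c = 2 * ((\<integral>\<^sup>+\<omega>. of_nat (counting (P \<omega>) a) \<partial>M) + I)"
  have bound: "(\<integral>\<^sup>+\<omega>. of_nat (min (counting (P \<omega>) b) n) \<partial>M) \<le> c" for n
  proof -
    define C where "C = ({a<..b} \<times> space M \<inter> {(s, \<omega>). card (P \<omega> \<inter> {0<..<s}) < n})"
    define x where "x = (\<integral>\<^sup>+\<omega>. of_nat (min (counting (P \<omega>) b) n) \<partial>M :: ennreal)"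
    have "x \<le> (\<integral>\<^sup>+\<omega>. of_nat n \<partial>M)"
      unfolding x_def by (intro nn_integral_mono) auto
    also have "\<dots> < \<infinity>"
      by (simp add: emeasure_space_1 of_nat_less_top)
    finally have x_fin: "x < \<infinity>" .
    have C: "indicator C \<in> borel_measurable (predictable (space M) (rh_history M P (renewal i)))"
      unfolding C_def
      by (intro borel_measurable_indicator predictable_count_before P_locally_finite counting_history history_space ab)
    have "x \<le> (\<integral>\<^sup>+\<omega>. of_nat (counting (P \<omega>) a) + of_nat (min (counting (P \<omega>) b) n - counting (P \<omega>) a) \<partial>M)"
      unfolding x_def of_nat_add[symmetric] by (intro nn_integral_mono of_nat_mono) simp
    also have "\<dots> = (\<integral>\<^sup>+\<omega>. of_nat (counting (P \<omega>) a) \<partial>M) + (\<integral>\<^sup>+\<omega>. of_nat (min (counting (P \<omega>) b) n - counting (P \<omega>) a) \<partial>M)"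
      by (intro nn_integral_add) measurable
    also have "(\<integral>\<^sup>+\<omega>. of_nat (min (counting (P \<omega>) b) n - counting (P \<omega>) a) \<partial>M) \<le>
        (\<integral>\<^sup>+\<omega>. (\<integral>\<^sup>+v. indicator C (v, \<omega>) \<partial>count_space (P \<omega>)) \<partial>M)"
    proof (rule nn_integral_mono)
      fix \<omega> assume \<omega>: "\<omega> \<in> space M"
      let ?S = "{v \<in> P \<omega> \<inter> {a<..b}. card (P \<omega> \<inter> {0<..<v}) < n}"
      have "finite ?S"
        using ab by (intro finite_subset[OF _ P_locally_finite[OF \<omega>, of b]]) auto
      have "(of_nat (min (counting (P \<omega>) b) n - counting (P \<omega>) a) :: ennreal) \<le> of_nat (card ?S)"
        using min_counting_le[OF P_locally_finite[OF \<omega>] P_locally_finite[OF \<omega>] ab(1), of b n] by (intro of_nat_mono) simp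
      also have "\<dots> = emeasure (count_space (P \<omega>)) ?S"
        using \<open>finite ?S\<close> by (subst emeasure_count_space_finite) auto
      also have "\<dots> = (\<integral>\<^sup>+v. indicator ?S v \<partial>count_space (P \<omega>))"
        by (subst nn_integral_indicator) auto
      also have "\<dots> = (\<integral>\<^sup>+v. indicator C (v, \<omega>) \<partial>count_space (P \<omega>))"
        using \<omega> by (intro nn_integral_cong) (auto simp: C_def indicator_def)
      finally show "of_nat (min (counting (P \<omega>) b) n - counting (P \<omega>) a) \<le> (\<integral>\<^sup>+v. indicator C (v, \<omega>) \<partial>count_space (P \<omega>))" .
    qed
    also have "\<dots> = (\<integral>\<^sup>+\<omega>. (\<integral>\<^sup>+v\<in>{0<..}. indicator C (v, \<omega>) *
        ennreal (rh_intensity \<mu> \<eta> h (P \<omega>) (\<lambda>j. renewal i j \<omega>) v) \<partial>lborel) \<partial>M)"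
      using intensity C unfolding has_intensity_def by blast
    also have "\<dots> \<le> (\<integral>\<^sup>+\<omega>. (\<integral>\<^sup>+u. immigration_rate \<mu> b u \<partial>lborel) * (\<Sum>j. indicator {..<ereal b} (renewal i j \<omega>)) +
      ennreal (1 / 2) * of_nat (min (counting (P \<omega>) b) n) \<partial>M)"
    proof (rule nn_integral_mono_AE)
      have "AE \<omega> in M. finite {j. renewal i j \<omega> < ereal b}"
        by (rule AE_finite_renewals) auto
      thus "AE \<omega> in M. (\<integral>\<^sup>+v\<in>{0<..}. indicator C (v, \<omega>) *
        ennreal (rh_intensity \<mu> \<eta> h (P \<omega>) (\<lambda>j. renewal i j \<omega>) v) \<partial>lborel) \<le>
        (\<integral>\<^sup>+u. immigration_rate \<mu> b u \<partial>lborel) * (\<Sum>j. indicator {..<ereal b} (renewal i j \<omega>)) +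
      ennreal (1 / 2) * of_nat (min (counting (P \<omega>) b) n)"
        using AE_space
      proof eventually_elim
        case (elim \<omega>)
        have "(\<integral>\<^sup>+v\<in>{0<..}. indicator C (v, \<omega>) *
            ennreal (rh_intensity \<mu> \<eta> h (P \<omega>) (\<lambda>j. renewal i j \<omega>) v) \<partial>lborel) \<le>
          (\<integral>\<^sup>+u. immigration_rate \<mu> b u \<partial>lborel) * (\<Sum>j. indicator {..<ereal b} (renewal i j \<omega>)) +
            ennreal (\<eta> * B * (b - a)) * of_nat (min (counting (P \<omega>) b) n)"
          unfolding C_def by (rule compensator_le[OF elim(2,1) ab(1) less_imp_le[OF ab(2)]]) (rule B, assumption, rule B)
        also have "ennreal (\<eta> * B * (b - a)) * of_nat (min (counting (P \<omega>) b) n) \<le>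
            ennreal (1 / 2) * of_nat (min (counting (P \<omega>) b) n)"
          by (rule mult_right_mono[OF ennreal_leI[OF small]]) (rule zero_le)
        finally show ?case
          by (simp only: add_left_mono)
      qed
    qed
    also have "\<dots> = I + ennreal (1 / 2) * x"
    proof -
      have K: "(\<lambda>\<omega>. \<Sum>j. indicator {..<ereal b} (renewal i j \<omega>) :: ennreal) \<in> borel_measurable M"
        and N: "(\<lambda>\<omega>. of_nat (min (counting (P \<omega>) b) n) :: ennreal) \<in> borel_measurable M"
        by measurable
      show ?thesis
        unfolding I_def x_def nn_integral_cmult[OF K, symmetric] nn_integral_cmult[OF N, symmetric]
        by (intro nn_integral_add borel_measurable_times_ennreal borel_measurable_const K N)
    qed
    finally have "x \<le> (\<integral>\<^sup>+\<omega>. of_nat (counting (P \<omega>) a) \<partial>M) + I + ennreal (1 / 2) * x"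
      by (simp add: add.assoc add_left_mono)
    from self_bound_ennreal[OF this x_fin] show ?thesis
      by (simp add: x_def c_def)
  qed
  have "(\<integral>\<^sup>+\<omega>. of_nat (counting (P \<omega>) b) \<partial>M) = (\<integral>\<^sup>+\<omega>. (SUP n. of_nat (min (counting (P \<omega>) b) n)) \<partial>M)"
  proof (rule nn_integral_cong)
    fix \<omega>
    show "(of_nat (counting (P \<omega>) b) :: ennreal) = (SUP n. of_nat (min (counting (P \<omega>) b) n))"
      by (intro antisym SUP_upper2[of "counting (P \<omega>) b"] SUP_least of_nat_mono) auto
  qed
  also have "\<dots> = (SUP n. \<integral>\<^sup>+\<omega>. of_nat (min (counting (P \<omega>) b) n) \<partial>M)"
  proof (rule nn_integral_monotone_convergence_SUP)
    show "incseq (\<lambda>n \<omega>. of_nat (min (counting (P \<omega>) b) n) :: ennreal)"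
      by (intro incseq_SucI le_funI of_nat_mono) auto
  qed measurable
  also have "\<dots> \<le> c"
    by (intro SUP_least bound)
  also have "c < \<infinity>"
    using fin I by (simp add: c_def ennreal_mult_less_top)
  finally show ?thesis .
qed

text \<open>
  Finitely many short steps reach any \<open>t\<close>, with a single bound for \<open>h\<close> on \<open>[0,t]\<close>.
\<close>

lemma expected_events_finite: "(\<integral>\<^sup>+\<omega>. of_nat (counting (P \<omega>) t) \<partial>M) < \<infinity>"
proof (cases "0 < t")
  case False
  thus ?thesis by (simp add: counting_def)
next
  case t: True
  obtain B where "\<forall>x\<in>h ` {0..t}. norm x \<le> B"
    using h_bounded[rule_format, of t] unfolding bounded_iff by blast
  have B: "h u \<le> B" if "u \<in> {0..t}" for u
  proof -
    have "norm (h u) \<le> B"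
      using \<open>\<forall>x\<in>h ` {0..t}. norm x \<le> B\<close> that by blast
    thus ?thesis by simp
  qed
  have B0: "0 \<le> B"
    using B[of 0] h_pos t by (auto intro: order_trans less_imp_le)
  obtain m :: nat where m: "2 * \<eta> * B * t < real m"
    using reals_Archimedean2 by blast
  hence m0: "0 < real m"
    using eta B0 t by (intro le_less_trans[OF _ m]) auto
  define \<delta> where "\<delta> = t / real m"
  have \<delta>: "0 < \<delta>" "\<eta> * B * \<delta> \<le> 1 / 2" "real m * \<delta> = t"
    using m m0 t by (auto simp: \<delta>_def field_simps)
  have "k \<le> m \<Longrightarrow> (\<integral>\<^sup>+\<omega>. of_nat (counting (P \<omega>) (real k * \<delta>)) \<partial>M) < \<infinity>" for k
  proof (induction k)
    case 0
    show ?case by (simp add: counting_def)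
  next
    case (Suc k)
    have "real (Suc k) * \<delta> \<le> t"
      unfolding \<delta>(3)[symmetric] using Suc.prems \<delta>(1) by (intro mult_right_mono) auto
    show ?case
    proof (rule expected_events_finite_step[of "real k * \<delta>" _ B])
      show "\<eta> * B * (real (Suc k) * \<delta> - real k * \<delta>) \<le> 1 / 2"
        using \<delta>(2) by (simp add: algebra_simps)
      show "h u \<le> B" if "u \<in> {0..real (Suc k) * \<delta>}" for u
        using that \<open>real (Suc k) * \<delta> \<le> t\<close> by (intro B) auto
      show "(\<integral>\<^sup>+\<omega>. of_nat (counting (P \<omega>) (real k * \<delta>)) \<partial>M) < \<infinity>"
        using Suc by simp
    qed (use \<delta>(1) B0 in auto)
  qed
  from this[of m] show ?thesis by (simp add: \<delta>)
qed

end

context renewal_hawkes_process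
begin

lemma integrable_counting: "integrable M (\<lambda>\<omega>. real (counting (P \<omega>) t))"
  using expected_events_finite[of t] by (simp add: integrable_iff_bounded ennreal_of_nat_eq_real_of_nat)

section \<open>The renewal function\<close>

lemma renewal_R1: "renewal R1 n \<omega> = ereal (\<Sum>k<n. Y k \<omega>)"
  by (induction n) (simp_all add: zero_ereal_def add.commute)

text \<open>
  Identifies the Stieltjes measure in the definition of the convolution powers.
\<close>

lemma interval_measure_F: "interval_measure F = distr M borel (Y n)"
proof -
  interpret \<nu>: real_distribution "distr M borel (Y n)"
    by (rule real_distribution_distr) measurable
  have cdf: "cdf (distr M borel (Y n)) = F"
  proof
    fix t
    have "cdf (distr M borel (Y n)) t = prob (Y n -` {..t} \<inter> space M)"
      by (simp add: cdf_def measure_distr)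
    also have "Y n -` {..t} \<inter> space M = {\<omega>\<in>space M. Y n \<omega> \<le> t}"
      by auto
    finally show "cdf (distr M borel (Y n)) t = F t"
      by (simp add: Y_cdf)
  qed
  note F = \<nu>.cdf_nondecreasing[unfolded cdf] \<nu>.cdf_is_right_cont[unfolded cdf]
    \<nu>.cdf_lim_at_bot[unfolded cdf] \<nu>.cdf_lim_at_top_prob[unfolded cdf]
  show ?thesis
  proof (rule cdf_unique)
    show "real_distribution (interval_measure F)"
      by (rule real_distribution_interval_measure) (rule F; assumption)+
    show "cdf (interval_measure F) = cdf (distr M borel (Y n))"
      unfolding cdf by (rule cdf_interval_measure) (rule F; assumption)+
  qed (rule \<nu>.real_distribution_axioms)
qed

lemma conv_power_eq_prob: "conv_power F n t = prob {\<omega>\<in>space M. (\<Sum>k<n. Y k \<omega>) \<le> t}"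
proof (induction n arbitrary: t)
  case 0
  show ?case by (simp add: indicator_def prob_space)
next
  case (Suc n)
  define S where "S \<omega> = (\<Sum>k<n. Y k \<omega>)" for \<omega>
  have S[measurable]: "S \<in> borel_measurable M"
    unfolding S_def by measurable
  define \<nu> where "\<nu> = distr M borel (Y n)"
  define \<sigma> where "\<sigma> = distr M borel S"
  interpret \<nu>: real_distribution \<nu>
    unfolding \<nu>_def by (rule real_distribution_distr) measurable
  interpret \<sigma>: real_distribution \<sigma>
    unfolding \<sigma>_def by (rule real_distribution_distr) measurable
  have cdf_\<sigma>: "cdf \<sigma> u = prob {\<omega>\<in>space M. S \<omega> \<le> u}" for u
  proof -
    have "S -` {..u} \<inter> space M = {\<omega>\<in>space M. S \<omega> \<le> u}" by auto
    thus ?thesis by (simp add: \<sigma>_def cdf_def measure_distr)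
  qed
  have IH: "conv_power F n u = cdf \<sigma> u" for u
    by (simp add: Suc.IH cdf_\<sigma> S_def)
  have "indep_var borel (Y n) borel S"
    unfolding S_def using Y_indep_vars by (intro indep_vars_sum) (auto intro: indep_vars_subset)
  hence distr: "distr M borel (\<lambda>\<omega>. Y n \<omega> + S \<omega>) = convolution \<nu> \<sigma>"
    unfolding \<nu>_def \<sigma>_def by (rule sum_indep_random_variable) measurable
  have meas: "(\<lambda>y. cdf \<sigma> (t - y)) \<in> borel_measurable \<nu>"
  proof -
    have [measurable]: "cdf \<sigma> \<in> borel_measurable borel"
      by (intro borel_measurable_mono monoI \<sigma>.cdf_nondecreasing)
    show ?thesis by measurable
  qed
  have "ennreal (prob {\<omega>\<in>space M. (\<Sum>k<Suc n. Y k \<omega>) \<le> t}) = emeasure (distr M borel (\<lambda>\<omega>. Y n \<omega> + S \<omega>)) {..t}"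
    by (subst emeasure_distr)
       (auto simp: emeasure_eq_measure S_def add.commute intro!: arg_cong[where f=prob])
  also have "\<dots> = (\<integral>\<^sup>+y. emeasure \<sigma> {a. a + y \<in> {..t}} \<partial>\<nu>)"
    unfolding distr by (rule convolution_emeasure)
      (auto simp: \<nu>.finite_measure_axioms \<sigma>.finite_measure_axioms)
  also have "\<dots> = (\<integral>\<^sup>+y. ennreal (cdf \<sigma> (t - y)) \<partial>\<nu>)"
  proof (rule nn_integral_cong)
    fix y
    have "{a. a + y \<in> {..t}} = {..t - y}" by auto
    thus "emeasure \<sigma> {a. a + y \<in> {..t}} = ennreal (cdf \<sigma> (t - y))"
      by (simp add: cdf_def \<sigma>.emeasure_eq_measure)
  qed
  finally have "prob {\<omega>\<in>space M. (\<Sum>k<Suc n. Y k \<omega>) \<le> t} = (LINT y|\<nu>. cdf \<sigma> (t - y))"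
    using meas by (subst integral_eq_nn_integral) (auto simp: \<sigma>.cdf_nonneg dest: arg_cong[where f=enn2real])
  thus ?case
    by (simp add: IH interval_measure_F[of n] \<nu>_def del: sum.lessThan_Suc)
qed

lemma summable_conv_power: "summable (\<lambda>n. conv_power F (Suc n) t)"
proof -
  \<comment> \<open>Moving from \<open>t\<close> to \<open>t + 1\<close> turns the condition \<open>\<le> t\<close> into a strict inequality.\<close>
  have "\<exists>C. \<forall>n. prob {\<omega>\<in>space M. renewal R1 n \<omega> < ereal (t + 1)} \<le> C * (3 / 4) ^ n"
    by (rule early_renewal_exponentially_unlikely) simp
  then obtain C where C: "\<forall>n. prob {\<omega>\<in>space M. renewal R1 n \<omega> < ereal (t + 1)} \<le> C * (3 / 4) ^ n"
    by (rule exE)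
  have "conv_power F n t \<le> C * (3 / 4) ^ n" for n
  proof -
    have "conv_power F n t \<le> prob {\<omega>\<in>space M. renewal R1 n \<omega> < ereal (t + 1)}"
      unfolding conv_power_eq_prob by (intro finite_measure_mono) (auto simp: renewal_R1)
    thus ?thesis using C[rule_format, of n] by (rule order_trans)
  qed
  hence bound: "norm (conv_power F n t) \<le> C * (3 / 4) ^ n" for n
    by (simp add: conv_power_eq_prob)
  have "summable (\<lambda>n. C * (3 / 4 :: real) ^ n)"
    by (simp add: summable_geometric)
  hence "summable (\<lambda>n. conv_power F n t)"
    using bound by (rule summable_comparison_test')
  thus ?thesis by (subst summable_Suc_iff)
qed

text \<open>
  The changes up to \<open>t\<close> are counted one by one; the \<open>(n+1)\<close>-st has occurred with probability
  \<open>F\<^sup>(\<^sup>n\<^sup>+\<^sup>1\<^sup>)(t)\<close>.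
\<close>

lemma sum_change_indicators:
  "(\<integral>\<^sup>+\<omega>. (\<Sum>n. indicator {n. (\<Sum>k\<le>n. Y k \<omega>) \<le> t} n) \<partial>M) = ennreal (\<Sum>n. conv_power F (Suc n) t)"
proof -
  have "(\<integral>\<^sup>+\<omega>. (\<Sum>n. indicator {n. (\<Sum>k\<le>n. Y k \<omega>) \<le> t} n) \<partial>M) =
      (\<integral>\<^sup>+\<omega>. (\<Sum>n. indicator {\<omega>\<in>space M. (\<Sum>k<Suc n. Y k \<omega>) \<le> t} \<omega>) \<partial>M)"
    by (intro nn_integral_cong suminf_cong) (simp add: indicator_def lessThan_Suc_atMost del: sum.lessThan_Suc)
  also have "\<dots> = (\<Sum>n. \<integral>\<^sup>+\<omega>. indicator {\<omega>\<in>space M. (\<Sum>k<Suc n. Y k \<omega>) \<le> t} \<omega> \<partial>M)"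
    by (intro nn_integral_suminf) measurable
  also have "\<dots> = (\<Sum>n. ennreal (conv_power F (Suc n) t))"
    by (simp add: emeasure_eq_measure conv_power_eq_prob del: sum.lessThan_Suc conv_power.simps)
  also have "\<dots> = ennreal (\<Sum>n. conv_power F (Suc n) t)"
    by (intro suminf_ennreal2 summable_conv_power) (simp add: conv_power_eq_prob del: conv_power.simps)
  finally show ?thesis .
qed

lemma AE_finite_changes: "AE \<omega> in M. finite {n. (\<Sum>k\<le>n. Y k \<omega>) \<le> t}"
proof -
  have "AE \<omega> in M. finite {j. renewal R1 j \<omega> < ereal (t + 1)}"
    by (rule AE_finite_renewals) simp
  thus ?thesis
  proof eventually_elim
    case (elim \<omega>)
    have "Suc ` {n. (\<Sum>k\<le>n. Y k \<omega>) \<le> t} \<subseteq> {j. renewal R1 j \<omega> < ereal (t + 1)}"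
      by (auto simp: renewal_R1 lessThan_Suc_atMost simp del: sum.lessThan_Suc)
    hence "finite (Suc ` {n. (\<Sum>k\<le>n. Y k \<omega>) \<le> t})"
      using elim finite_subset by blast
    thus ?case by (simp add: finite_image_iff)
  qed
qed

lemma env_changes_measurable[measurable]: "(\<lambda>\<omega>. env_changes (\<lambda>k. Y k \<omega>) t) \<in> M \<rightarrow>\<^sub>M count_space UNIV"
  unfolding env_changes_def by measurable

text \<open>
  Almost surely the counted set is finite, so its cardinality, which is \<open>0\<close> for infinite sets, agrees with
  the sum of indicators.
\<close>

lemma nn_integral_env_changes:
  "(\<integral>\<^sup>+\<omega>. ennreal (real (env_changes (\<lambda>k. Y k \<omega>) t)) \<partial>M) = ennreal (\<Sum>n. conv_power F (Suc n) t)"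
proof -
  have "AE \<omega> in M. ennreal (real (env_changes (\<lambda>k. Y k \<omega>) t)) = (\<Sum>n. indicator {n. (\<Sum>k\<le>n. Y k \<omega>) \<le> t} n)"
    using AE_finite_changes[of t]
    by eventually_elim (simp add: suminf_indicator_eq_count env_changes_def ennreal_of_nat_eq_real_of_nat)
  thus ?thesis
    unfolding sum_change_indicators[symmetric] by (rule nn_integral_cong_AE)
qed

lemma integrable_env_changes: "integrable M (\<lambda>\<omega>. real (env_changes (\<lambda>k. Y k \<omega>) t))"
  using nn_integral_env_changes[of t] by (simp add: integrable_iff_bounded)

lemma renewal_function: "(\<lambda>n. conv_power F (Suc n) t) sums expected_changes M Y t"
proof -
  have "0 \<le> (\<Sum>n. conv_power F (Suc n) t)"
    by (intro suminf_nonneg summable_conv_power) (simp add: conv_power_eq_prob del: conv_power.simps)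
  hence "expected_changes M Y t = (\<Sum>n. conv_power F (Suc n) t)"
    unfolding expected_changes_def by (subst integral_eq_nn_integral) (auto simp: nn_integral_env_changes)
  thus ?thesis
    using summable_conv_power[of t] by (simp add: sums_iff del: conv_power.simps)
qed

lemma expected_failures_bounds:
  assumes "s \<le> t" shows "0 \<le> expected_failures M P s" "expected_failures M P s \<le> expected_failures M P t"
  unfolding expected_failures_def
  by (simp, intro integral_mono integrable_counting)
     (use assms P_locally_finite in \<open>auto simp: counting_def intro!: card_mono\<close>)

lemma expected_changes_bounds:
  assumes "s \<le> t" shows "0 \<le> expected_changes M Y s" "expected_changes M Y s \<le> expected_changes M Y t"
proof -
  show "0 \<le> expected_changes M Y s"
    by (simp add: expected_changes_def)
  have "AE \<omega> in M. real (env_changes (\<lambda>k. Y k \<omega>) s) \<le> real (env_changes (\<lambda>k. Y k \<omega>) t)"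
    using AE_finite_changes[of t]
    by eventually_elim (use assms in \<open>auto simp: env_changes_def intro!: card_mono\<close>)
  thus "expected_changes M Y s \<le> expected_changes M Y t"
    unfolding expected_changes_def by (intro integral_mono_AE integrable_env_changes)
qed

end

section \<open>The cost rate over independent cycles\<close>

lemma counting_cycle_measurable: "(\<lambda>p. real (fst p s)) \<in> borel_measurable cycle_space"
proof -
  have "(\<lambda>p. fst p s) \<in> cycle_space \<rightarrow>\<^sub>M count_space UNIV"
    unfolding cycle_space_def
    by (rule measurable_compose[OF measurable_fst measurable_component_singleton]) simp
  thus ?thesis by measurable
qed

lemma env_changes_cycle_measurable: "(\<lambda>p. real (env_changes (fst (snd p)) s)) \<in> borel_measurable cycle_space"
  unfolding env_changes_def cycle_space_def by measurable

text \<open>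
  The counts are measurable functions of the cycle, so equality in law of the cycles suffices.
\<close>

lemma independent_copies_expectations:
  assumes "prob_space M" "independent_copies M P Y D"
  shows "expected_failures M (P j) s = expected_failures M (P 0) s"
    and "expected_changes M (Y j) s = expected_changes M (Y 0) s"
proof -
  interpret prob_space M by fact
  have meas: "cycle (P j) (Y j) (D j) \<in> M \<rightarrow>\<^sub>M cycle_space" for j
    using assms(2) by (auto simp: independent_copies_def indep_vars_def)
  have distr: "distr M cycle_space (cycle (P j) (Y j) (D j)) = distr M cycle_space (cycle (P 0) (Y 0) (D 0))"
    using assms(2) by (auto simp: independent_copies_def)
  have "expected_failures M (P j) s = (LINT p|distr M cycle_space (cycle (P j) (Y j) (D j)). real (fst p s))" for j
    by (subst integral_distr[OF meas counting_cycle_measurable]) (simp add: expected_failures_def cycle_def)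
  thus "expected_failures M (P j) s = expected_failures M (P 0) s"
    by (simp add: distr)
  have "expected_changes M (Y j) s = (LINT p|distr M cycle_space (cycle (P j) (Y j) (D j)). real (env_changes (fst (snd p)) s))" for j
    by (subst integral_distr[OF meas env_changes_cycle_measurable]) (simp add: expected_changes_def cycle_def)
  thus "expected_changes M (Y j) s = expected_changes M (Y 0) s"
    by (simp add: distr)
qed

text \<open>
  The number of completed periods differs from \<open>t/T\<close> by at most \<open>1\<close> and the running period contributes a
  bounded amount, so the numerator differs from \<open>a t/T\<close> by a bounded amount.
\<close>

lemma renewal_reward_limit:
  fixes L :: "real \<Rightarrow> real"
  assumes T: "0 < T"
    and L: "\<And>t. 0 \<le> t \<Longrightarrow> L t = real (nat \<lfloor>t / T\<rfloor>) * a + g (t - real (nat \<lfloor>t / T\<rfloor>) * T)"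
    and g: "\<And>s. 0 \<le> s \<Longrightarrow> s \<le> T \<Longrightarrow> \<bar>g s\<bar> \<le> K"
  shows "((\<lambda>t. L t / t) \<longlongrightarrow> a / T) at_top"
proof (rule Lim_null[THEN iffD2], rule Lim_null_comparison)
  show "\<forall>\<^sub>F t in at_top. norm (L t / t - a / T) \<le> (\<bar>a\<bar> + K) / t"
    using eventually_gt_at_top[of 0]
  proof eventually_elim
    case (elim t)
    define m where "m = real (nat \<lfloor>t / T\<rfloor>)"
    have m: "m \<le> t / T" "t / T < m + 1"
      using elim T by (auto simp: m_def)
    hence s: "0 \<le> t - m * T" "t - m * T \<le> T"
      using T by (auto simp: field_simps)
    have "\<bar>(m - t / T) * a\<bar> \<le> 1 * \<bar>a\<bar>"
      unfolding abs_mult using m by (intro mult_right_mono) auto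
    hence "\<bar>(m - t / T) * a + g (t - m * T)\<bar> \<le> \<bar>a\<bar> + K"
      using g[OF s] by linarith
    moreover have "L t / t - a / T = ((m - t / T) * a + g (t - m * T)) / t"
      using L[of t] elim T by (simp add: m_def[symmetric] field_simps)
    ultimately show ?case
      using elim by (simp add: divide_right_mono)
  qed
  show "((\<lambda>t. (\<bar>a\<bar> + K) / t) \<longlongrightarrow> 0) at_top"
    by (intro tendsto_divide_0[OF tendsto_const] filterlim_at_top_imp_at_infinity filterlim_ident)
qed

theorem proposition4p1:
  fixes M :: "'a measure" and i :: renewal_kind
    and \<mu> h F f :: "real \<Rightarrow> real" and \<eta> c_f c_Ip c_p :: real
    and P :: "nat \<Rightarrow> 'a \<Rightarrow> real set"
    and Y :: "nat \<Rightarrow> nat \<Rightarrow> 'a \<Rightarrow> real"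
    and D :: "nat \<Rightarrow> nat \<Rightarrow> 'a \<Rightarrow> ereal"
  assumes "prob_space M"
    and mu: "\<forall>t\<ge>0. 0 < \<mu> t" "\<forall>t. set_integrable lborel {0..t} \<mu>"
    and eta: "0 < \<eta>"
    and h: "\<forall>t\<ge>0. 0 < h t" "\<forall>t. bounded (h ` {0..t})"
      "set_integrable lborel {0..} h" "(LBINT t:{0..}. h t) = 1"
    and cycles: "\<forall>j. renewal_hawkes M i \<mu> \<eta> h F f (P j) (Y j) (D j)"
      "independent_copies M P Y D"
  shows "(\<forall>t\<ge>0. integrable M (\<lambda>\<omega>. real (counting (P 0 \<omega>) t)) \<and>
            integrable M (\<lambda>\<omega>. real (env_changes (\<lambda>k. Y 0 k \<omega>) t)) \<and>
            (\<forall>T>0. integrable M (maintenance_loss c_f c_Ip c_p P Y T t))) \<and>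
         (\<forall>t\<ge>0. (\<lambda>n. conv_power F (Suc n) t) sums expected_changes M (Y 0) t) \<and>
         (\<forall>T>0. ((\<lambda>t. (LINT \<omega>|M. maintenance_loss c_f c_Ip c_p P Y T t \<omega>) / t) \<longlongrightarrow>
                    (c_f * expected_failures M (P 0) T + c_Ip * expected_changes M (Y 0) T + c_p) / T) at_top \<and>
                 long_run_loss M c_f c_Ip c_p P Y T = (c_f * expected_failures M (P 0) T + c_Ip * expected_changes M (Y 0) T + c_p) / T) \<and>
         (\<forall>T. optimal_period (long_run_loss M c_f c_Ip c_p P Y) T \<longleftrightarrow>
              optimal_period (\<lambda>T. (c_f * expected_failures M (P 0) T + c_Ip * expected_changes M (Y 0) T + c_p) / T) T)"
proof -
  interpret prob_space M by fact
  have process: "renewal_hawkes_process M i \<mu> h F f \<eta> (P j) (Y j) (D j)" for j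
    using cycles(1) mu eta h by unfold_locales auto
  interpret first: renewal_hawkes_process M i \<mu> h F f \<eta> "P 0" "Y 0" "D 0"
    by (rule process)
  note intN = renewal_hawkes_process.integrable_counting[OF process]
  note intR = renewal_hawkes_process.integrable_env_changes[OF process]
  note copies = independent_copies_expectations[OF \<open>prob_space M\<close> cycles(2)]
  let ?g = "\<lambda>s. c_f * expected_failures M (P 0) s + c_Ip * expected_changes M (Y 0) s"
  let ?L = "maintenance_loss c_f c_Ip c_p P Y"
  have intL: "integrable M (?L T t)" for T t
    unfolding maintenance_loss_def[abs_def] Let_def
    by (intro Bochner_Integration.integrable_add Bochner_Integration.integrable_sum
      integrable_mult_right intN intR) simp
  have minor: "expectation (\<lambda>\<omega>. c_f * real (counting (P j \<omega>) s) + c_Ip * real (env_changes (\<lambda>k. Y j k \<omega>) s)) = ?g s" for j s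
    using copies[of j s] intN[of j s] intR[of j s]
    by (simp add: expected_failures_def expected_changes_def)
  have EL: "expectation (?L T t) = real (nat \<lfloor>t / T\<rfloor>) * (?g T + c_p) + ?g (t - real (nat \<lfloor>t / T\<rfloor>) * T)" for T t
  proof -
    have int: "integrable M (\<lambda>\<omega>. c_f * real (counting (P j \<omega>) s) + c_Ip * real (env_changes (\<lambda>k. Y j k \<omega>) s))" for j s
      by (intro Bochner_Integration.integrable_add integrable_mult_right intN intR)
    have int': "integrable M (\<lambda>\<omega>. c_f * real (counting (P j \<omega>) s) + c_Ip * real (env_changes (\<lambda>k. Y j k \<omega>) s) + c_p)" for j s
      by (intro Bochner_Integration.integrable_add int) simp
    have full: "expectation (\<lambda>\<omega>. c_f * real (counting (P j \<omega>) s) + c_Ip * real (env_changes (\<lambda>k. Y j k \<omega>) s) + c_p) = ?g s + c_p" for j s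
      by (subst Bochner_Integration.integral_add[OF int]) (simp_all add: minor prob_space)
    show ?thesis
      unfolding maintenance_loss_def[abs_def] Let_def
      by (subst Bochner_Integration.integral_add, intro Bochner_Integration.integrable_sum int', rule int,
          subst Bochner_Integration.integral_sum, rule int')
         (simp add: full minor)
  qed
  have lim: "((\<lambda>t. expectation (?L T t) / t) \<longlongrightarrow> (?g T + c_p) / T) at_top" if T: "0 < T" for T
  proof (rule renewal_reward_limit[where g = ?g])
    fix s assume s: "0 \<le> s" "s \<le> T"
    have "\<bar>c_f * expected_failures M (P 0) s\<bar> \<le> \<bar>c_f\<bar> * expected_failures M (P 0) T"
      unfolding abs_mult using first.expected_failures_bounds[OF s(2)] by (intro mult_left_mono) auto
    moreover have "\<bar>c_Ip * expected_changes M (Y 0) s\<bar> \<le> \<bar>c_Ip\<bar> * expected_changes M (Y 0) T"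
      unfolding abs_mult using first.expected_changes_bounds[OF s(2)] by (intro mult_left_mono) auto
    ultimately show "\<bar>?g s\<bar> \<le> \<bar>c_f\<bar> * expected_failures M (P 0) T + \<bar>c_Ip\<bar> * expected_changes M (Y 0) T"
      by linarith
  qed (use T EL in auto)
  have long_run: "long_run_loss M c_f c_Ip c_p P Y T = (?g T + c_p) / T" if "0 < T" for T
    unfolding long_run_loss_def using lim[OF that] by (intro tendsto_Lim) simp_all
  have "optimal_period (long_run_loss M c_f c_Ip c_p P Y) T \<longleftrightarrow> optimal_period (\<lambda>T. (?g T + c_p) / T) T" for T
    unfolding optimal_period_def is_arg_min_def using long_run by auto
  thus ?thesis
    using intN intR intL first.renewal_function lim long_run by (intro conjI allI impI) (assumption | blast)+
qed

end
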